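(* Let $E$ and $F$ be graphs and let $\psi : L_{\mathbb{C}}(E) \to L_{\mathbb{C}}(F)$ be an algebra homomorphism. Then $\psi$ is an algebra $*$-homomorphism if and only if the following two conditions are satisfied: (i) $\|\psi(s_e)\| \le 1$ and $\|\psi(s_e^* )\| \le 1$ for all $e \in E^1$, and (ii) $\|\psi(p_v)\| \le 1$ for each $v \in E^0$ that is a source.
   Context: A graph $E=(E^0,E^1,r,s)$ consists of a countable set $E^0$ of vertices, a countable set $E^1$ of edges, and maps $r,s:E^1\to E^0$ (range and source). A vertex $v$ is regular if $0<|s^{-1}(v)|<\infty$, and is a source if $r^{-1}(v)=\emptyset$. $C^*(E)$ is the universal $C^*$-algebra generated by mutually orthogonal projections $\{p_v:v\in E^0\}$ and partial isometries $\{s_e:e\in E^1\}$ with mutually orthogonal ranges ($s_e^*s_f=0$ for $e\ne f$) satisfying $s_e^*s_e=p_{r(e)}$ and $s_es_e^*\le p_{s(e)}$ for all $e\in E^1$, and $p_v=\sum_{s(e)=v}s_es_e^*$ for every regular vertex $v$. $L_{\mathbb{C}}(E)$ (the Leavitt path algebra) is the (not necessarily unital) associative $\mathbb{C}$-algebra generated by pairwise orthogonal idempotents $\{v:v\in E^0\}$ and elements $\{e,e^*:e\in E^1\}$ subject to $s(e)e=er(e)=e$, $r(e)e^*=e^*s(e)=e^*$, $e^*f=\delta_{e,f}\,r(e)$ for $e,f\in E^1$, and $v=\sum_{s(e)=v}ee^*$ for every regular vertex $v$. It is a $*$-algebra under the conjugate-linear, product-reversing involution with $v^*=v$ and $e\mapsto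 e^*$. There is a canonical injective algebra $*$-homomorphism $L_{\mathbb{C}}(E)\to C^*(E)$, $v\mapsto p_v$, $e\mapsto s_e$, with dense image; via it $L_{\mathbb{C}}(E)$ is regarded as a $*$-subalgebra of $C^*(E)$, its generators are written $p_v,s_e,s_e^*$, and $\|\cdot\|$ on $L_{\mathbb{C}}(E)$ denotes the restriction of the norm of $C^*(E)$ (likewise for $F$). An algebra homomorphism is a $\mathbb{C}$-linear multiplicative map (not required to preserve identities); an algebra $*$-homomorphism is one that is also $*$-preserving. *)

theory Defs
  imports "HOL-Analysis.Analysis" "Graph_Theory.Digraph"
begin

section \<open>The Hilbert space of square-summable sequences\<close>

typedef ell2 = "{x :: nat \<Rightarrow> complex. summable (\<lambda>n. (cmod (x n))\<^sup>2)}"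
  morphisms ell2_nth Abs_ell2
  by (rule exI[of _ "\<lambda>_. 0"]) simp

setup_lifting type_definition_ell2

lemma summable_ell2_add:
  fixes x y :: "nat \<Rightarrow> complex"
  assumes "summable (\<lambda>n. (cmod (x n))\<^sup>2)" "summable (\<lambda>n. (cmod (y n))\<^sup>2)"
  shows "summable (\<lambda>n. (cmod (x n + y n))\<^sup>2)"
proof (rule summable_comparison_test')
  show "summable (\<lambda>n. 2 * (cmod (x n))\<^sup>2 + 2 * (cmod (y n))\<^sup>2)"
    using assms by (intro summable_add summable_mult)
  fix n
  have "(cmod (x n + y n))\<^sup>2 \<le> (cmod (x n) + cmod (y n))\<^sup>2"
    by (simp add: norm_triangle_ineq power_mono)
  also have "\<dots> \<le> 2 * (cmod (x n))\<^sup>2 + 2 * (cmod (y n))\<^sup>2"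
    using sum_squares_bound[of "cmod (x n)" "cmod (y n)"] by (simp add: power2_sum)
  finally show "norm ((cmod (x n + y n))\<^sup>2) \<le> 2 * (cmod (x n))\<^sup>2 + 2 * (cmod (y n))\<^sup>2"
    by simp
qed

lemma summable_ell2_scale:
  fixes x :: "nat \<Rightarrow> complex"
  assumes "summable (\<lambda>n. (cmod (x n))\<^sup>2)"
  shows "summable (\<lambda>n. (cmod (c * x n))\<^sup>2)"
  using summable_mult[OF assms, of "(cmod c)\<^sup>2"] by (simp add: norm_mult power_mult_distrib)

lemma summable_ell2_inner:
  fixes x y :: "nat \<Rightarrow> complex"
  assumes "summable (\<lambda>n. (cmod (x n))\<^sup>2)" "summable (\<lambda>n. (cmod (y n))\<^sup>2)"
  shows "summable (\<lambda>n. x n \<bullet> y n)"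
proof (rule summable_comparison_test')
  show "summable (\<lambda>n. (cmod (x n))\<^sup>2 + (cmod (y n))\<^sup>2)"
    using assms by (rule summable_add)
  fix n
  have "norm (x n \<bullet> y n) \<le> cmod (x n) * cmod (y n)"
    using Cauchy_Schwarz_ineq2 by simp
  also have "\<dots> \<le> (cmod (x n))\<^sup>2 + (cmod (y n))\<^sup>2"
    using sum_squares_bound[of "cmod (x n)" "cmod (y n)"]
      mult_nonneg_nonneg[OF norm_ge_zero[of "x n"] norm_ge_zero[of "y n"]] by linarith
  finally show "norm (x n \<bullet> y n) \<le> (cmod (x n))\<^sup>2 + (cmod (y n))\<^sup>2" .
qed

lift_definition cscale :: "complex \<Rightarrow> ell2 \<Rightarrow> ell2" is "\<lambda>c x n. c * x n"
  by (simp add: summable_ell2_scale)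

instantiation ell2 :: real_vector
begin

lift_definition zero_ell2 :: ell2 is "\<lambda>_. 0" by simp
lift_definition plus_ell2 :: "ell2 \<Rightarrow> ell2 \<Rightarrow> ell2" is "\<lambda>x y n. x n + y n"
  by (simp add: summable_ell2_add)
lift_definition uminus_ell2 :: "ell2 \<Rightarrow> ell2" is "\<lambda>x n. - x n" by simp
lift_definition minus_ell2 :: "ell2 \<Rightarrow> ell2 \<Rightarrow> ell2" is "\<lambda>x y n. x n - y n"
  subgoal for x y using summable_ell2_add[of x "\<lambda>n. - y n"] by simp
  done
lift_definition scaleR_ell2 :: "real \<Rightarrow> ell2 \<Rightarrow> ell2" is "\<lambda>r x n. r *\<^sub>R x n"
  by (simp add: scaleR_conv_of_real summable_ell2_scale del: norm_mult norm_of_real)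

instance
  by standard (transfer; simp add: algebra_simps)+

end

text \<open>
  The inner product below is the real part of the usual complex inner product.  It induces the
  same norm, and a complex-linear operator has the same adjoint with respect to either of them.
\<close>

instantiation ell2 :: real_inner
begin

lift_definition inner_ell2 :: "ell2 \<Rightarrow> ell2 \<Rightarrow> real" is "\<lambda>x y. \<Sum>n. x n \<bullet> y n" .

definition norm_ell2 :: "ell2 \<Rightarrow> real" where "norm_ell2 x = sqrt (x \<bullet> x)"
definition dist_ell2 :: "ell2 \<Rightarrow> ell2 \<Rightarrow> real" where "dist_ell2 x y = norm (x - y)"
definition sgn_ell2 :: "ell2 \<Rightarrow> ell2" where "sgn_ell2 x = x /\<^sub>R norm x"
definition uniformity_ell2 :: "(ell2 \<times> ell2) filter" where
  "uniformity_ell2 = (INF e\<in>{0 <..}. principal {(x, y). dist x y < e})"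
definition open_ell2 :: "ell2 set \<Rightarrow> bool" where
  "open_ell2 U = (\<forall>x\<in>U. \<forall>\<^sub>F (x', y) in uniformity. x' = x \<longrightarrow> y \<in> U)"

instance
proof
  fix x y z :: ell2 and a :: real and U :: "ell2 set"
  show "dist x y = norm (x - y)" "sgn x = x /\<^sub>R norm x" "norm x = sqrt (x \<bullet> x)"
    by (simp_all only: dist_ell2_def sgn_ell2_def norm_ell2_def)
  show "(uniformity :: (ell2 \<times> ell2) filter) = (INF e\<in>{0 <..}. principal {(x, y). dist x y < e})"
    by (rule uniformity_ell2_def)
  show "open U = (\<forall>x\<in>U. \<forall>\<^sub>F (x', y) in uniformity. x' = x \<longrightarrow> y \<in> U)"
    by (rule open_ell2_def)
  show "x \<bullet> y = y \<bullet> x" by transfer (simp add: inner_commute)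
  show "(x + y) \<bullet> z = x \<bullet> z + y \<bullet> z"
    by transfer (simp add: inner_add_left suminf_add summable_ell2_inner)
  show "(a *\<^sub>R x) \<bullet> y = a * (x \<bullet> y)"
    by transfer (simp add: suminf_mult summable_ell2_inner)
  show "0 \<le> x \<bullet> x"
    by transfer (simp add: suminf_nonneg summable_ell2_inner)
  show "(x \<bullet> x = 0) = (x = 0)"
    by transfer (simp add: suminf_eq_zero_iff summable_ell2_inner fun_eq_iff)
qed

end

section \<open>Bounded operators\<close>

definition bounded_operator :: "(ell2 \<Rightarrow> ell2) \<Rightarrow> bool" where
  "bounded_operator T \<longleftrightarrow> bounded_linear T \<and> (\<forall>c x. T (cscale c x) = cscale c (T x))"

definition projection :: "(ell2 \<Rightarrow> ell2) \<Rightarrow> bool" where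
  "projection T \<longleftrightarrow> bounded_operator T \<and> T \<circ> T = T \<and> adjoint T = T"

definition partial_isometry :: "(ell2 \<Rightarrow> ell2) \<Rightarrow> bool" where
  "partial_isometry T \<longleftrightarrow> bounded_operator T \<and> T \<circ> adjoint T \<circ> T = T"

definition operator_le :: "(ell2 \<Rightarrow> ell2) \<Rightarrow> (ell2 \<Rightarrow> ell2) \<Rightarrow> bool" where
  "operator_le T U \<longleftrightarrow> adjoint (\<lambda>x. U x - T x) = (\<lambda>x. U x - T x) \<and> (\<forall>x. 0 \<le> (U x - T x) \<bullet> x)"

section \<open>Complex star-algebras\<close>

text \<open>Algebras here are not assumed to be unital.\<close>

record 'a star_algebra =
  alg_carrier :: "'a set"
  alg_add :: "'a \<Rightarrow> 'a \<Rightarrow> 'a"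
  alg_scale :: "complex \<Rightarrow> 'a \<Rightarrow> 'a"
  alg_mult :: "'a \<Rightarrow> 'a \<Rightarrow> 'a"
  alg_star :: "'a \<Rightarrow> 'a"

record 'a normed_star_algebra = "'a star_algebra" +
  alg_norm :: "'a \<Rightarrow> real"

definition algebra_hom ::
  "('a, 'm) star_algebra_scheme \<Rightarrow> ('b, 'n) star_algebra_scheme \<Rightarrow> ('a \<Rightarrow> 'b) \<Rightarrow> bool" where
  "algebra_hom A B f \<longleftrightarrow>
    (\<forall>x\<in>alg_carrier A. f x \<in> alg_carrier B) \<and>
    (\<forall>x\<in>alg_carrier A. \<forall>y\<in>alg_carrier A. f (alg_add A x y) = alg_add B (f x) (f y)) \<and>
    (\<forall>c. \<forall>x\<in>alg_carrier A. f (alg_scale A c x) = alg_scale B c (f x)) \<and>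
    (\<forall>x\<in>alg_carrier A. \<forall>y\<in>alg_carrier A. f (alg_mult A x y) = alg_mult B (f x) (f y))"

definition algebra_star_hom ::
  "('a, 'm) star_algebra_scheme \<Rightarrow> ('b, 'n) star_algebra_scheme \<Rightarrow> ('a \<Rightarrow> 'b) \<Rightarrow> bool" where
  "algebra_star_hom A B f \<longleftrightarrow>
    algebra_hom A B f \<and> (\<forall>x\<in>alg_carrier A. f (alg_star A x) = alg_star B (f x))"

section \<open>Graphs\<close>

text \<open>
  A graph is a \<^const>\<open>wf_digraph\<close> with countably many vertices and edges; the source of an edge
  is its \<^const>\<open>tail\<close> and its range is its \<^const>\<open>head\<close>.
\<close>

definition regular_vertex :: "('v, 'e) pre_digraph \<Rightarrow> 'v \<Rightarrow> bool" where
  "regular_vertex E v \<longleftrightarrow> v \<in> verts E \<and> out_arcs E v \<noteq> {} \<and> finite (out_arcs E v)"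

definition source_vertex :: "('v, 'e) pre_digraph \<Rightarrow> 'v \<Rightarrow> bool" where
  "source_vertex E v \<longleftrightarrow> v \<in> verts E \<and> in_arcs E v = {}"

section \<open>Leavitt path algebras\<close>

text \<open>
  The algebra presented by generators and relations is built as the algebra of formal expressions
  in the generators, modulo the least congruence that contains the axioms of a (non-unital)
  associative complex algebra and the defining relations.  \<open>Ghost e\<close> is the generator \<open>e\<^sup>*\<close>.
\<close>

datatype ('v, 'e) lpa_term =
    Vertex 'v
  | Edge 'e
  | Ghost 'e
  | Zero
  | Add "('v, 'e) lpa_term" "('v, 'e) lpa_term"
  | Scale complex "('v, 'e) lpa_term"
  | Mult "('v, 'e) lpa_term" "('v, 'e) lpa_term"

inductive_set lpa_terms :: "('v, 'e) pre_digraph \<Rightarrow> ('v, 'e) lpa_term set"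
  for E :: "('v, 'e) pre_digraph" where
  "v \<in> verts E \<Longrightarrow> Vertex v \<in> lpa_terms E"
| "e \<in> arcs E \<Longrightarrow> Edge e \<in> lpa_terms E"
| "e \<in> arcs E \<Longrightarrow> Ghost e \<in> lpa_terms E"
| "Zero \<in> lpa_terms E"
| "a \<in> lpa_terms E \<Longrightarrow> b \<in> lpa_terms E \<Longrightarrow> Add a b \<in> lpa_terms E"
| "a \<in> lpa_terms E \<Longrightarrow> Scale c a \<in> lpa_terms E"
| "a \<in> lpa_terms E \<Longrightarrow> b \<in> lpa_terms E \<Longrightarrow> Mult a b \<in> lpa_terms E"

inductive lpa_cong :: "('v, 'e) pre_digraph \<Rightarrow> ('v, 'e) lpa_term \<Rightarrow> ('v, 'e) lpa_term \<Rightarrow> bool"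
  for E :: "('v, 'e) pre_digraph" where
  refl: "lpa_cong E a a"
| sym: "lpa_cong E a b \<Longrightarrow> lpa_cong E b a"
| trans: "lpa_cong E a b \<Longrightarrow> lpa_cong E b c \<Longrightarrow> lpa_cong E a c"
| add_cong: "lpa_cong E a a' \<Longrightarrow> lpa_cong E b b' \<Longrightarrow> lpa_cong E (Add a b) (Add a' b')"
| scale_cong: "lpa_cong E a a' \<Longrightarrow> lpa_cong E (Scale k a) (Scale k a')"
| mult_cong: "lpa_cong E a a' \<Longrightarrow> lpa_cong E b b' \<Longrightarrow> lpa_cong E (Mult a b) (Mult a' b')"
| add_assoc: "lpa_cong E (Add (Add a b) c) (Add a (Add b c))"
| add_commute: "lpa_cong E (Add a b) (Add b a)"
| add_zero: "lpa_cong E (Add Zero a) a"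
| add_inverse: "lpa_cong E (Add a (Scale (-1) a)) Zero"
| scale_one: "lpa_cong E (Scale 1 a) a"
| scale_scale: "lpa_cong E (Scale k (Scale l a)) (Scale (k * l) a)"
| scale_add_right: "lpa_cong E (Scale k (Add a b)) (Add (Scale k a) (Scale k b))"
| scale_add_left: "lpa_cong E (Scale (k + l) a) (Add (Scale k a) (Scale l a))"
| mult_assoc: "lpa_cong E (Mult (Mult a b) c) (Mult a (Mult b c))"
| mult_add_left: "lpa_cong E (Mult (Add a b) c) (Add (Mult a c) (Mult b c))"
| mult_add_right: "lpa_cong E (Mult a (Add b c)) (Add (Mult a b) (Mult a c))"
| mult_scale_left: "lpa_cong E (Mult (Scale k a) b) (Scale k (Mult a b))"
| mult_scale_right: "lpa_cong E (Mult a (Scale k b)) (Scale k (Mult a b))"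
| vertex_idem: "v \<in> verts E \<Longrightarrow> lpa_cong E (Mult (Vertex v) (Vertex v)) (Vertex v)"
| vertex_orth: "v \<in> verts E \<Longrightarrow> w \<in> verts E \<Longrightarrow> v \<noteq> w \<Longrightarrow>
    lpa_cong E (Mult (Vertex v) (Vertex w)) Zero"
| source_edge: "e \<in> arcs E \<Longrightarrow> lpa_cong E (Mult (Vertex (tail E e)) (Edge e)) (Edge e)"
| edge_range: "e \<in> arcs E \<Longrightarrow> lpa_cong E (Mult (Edge e) (Vertex (head E e))) (Edge e)"
| range_ghost: "e \<in> arcs E \<Longrightarrow> lpa_cong E (Mult (Vertex (head E e)) (Ghost e)) (Ghost e)"
| ghost_source: "e \<in> arcs E \<Longrightarrow> lpa_cong E (Mult (Ghost e) (Vertex (tail E e))) (Ghost e)"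
| ghost_edge: "e \<in> arcs E \<Longrightarrow> lpa_cong E (Mult (Ghost e) (Edge e)) (Vertex (head E e))"
| ghost_edge_orth: "e \<in> arcs E \<Longrightarrow> f \<in> arcs E \<Longrightarrow> e \<noteq> f \<Longrightarrow>
    lpa_cong E (Mult (Ghost e) (Edge f)) Zero"
| regular: "regular_vertex E v \<Longrightarrow> distinct es \<Longrightarrow> set es = out_arcs E v \<Longrightarrow>
    lpa_cong E (Vertex v) (foldr (\<lambda>e. Add (Mult (Edge e) (Ghost e))) es Zero)"

definition lpa_rel :: "('v, 'e) pre_digraph \<Rightarrow> (('v, 'e) lpa_term \<times> ('v, 'e) lpa_term) set" where
  "lpa_rel E = {(a, b). a \<in> lpa_terms E \<and> b \<in> lpa_terms E \<and> lpa_cong E a b}"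

primrec star_term :: "('v, 'e) lpa_term \<Rightarrow> ('v, 'e) lpa_term" where
  "star_term (Vertex v) = Vertex v"
| "star_term (Edge e) = Ghost e"
| "star_term (Ghost e) = Edge e"
| "star_term Zero = Zero"
| "star_term (Add a b) = Add (star_term a) (star_term b)"
| "star_term (Scale k a) = Scale (cnj k) (star_term a)"
| "star_term (Mult a b) = Mult (star_term b) (star_term a)"

definition leavitt_path_algebra :: "('v, 'e) pre_digraph \<Rightarrow> ('v, 'e) lpa_term set star_algebra" where
  "leavitt_path_algebra E = \<lparr>
     alg_carrier = lpa_terms E // lpa_rel E,
     alg_add = (\<lambda>A B. \<Union>a\<in>A. \<Union>b\<in>B. lpa_rel E `` {Add a b}),
     alg_scale = (\<lambda>k A. \<Union>a\<in>A. lpa_rel E `` {Scale k a}),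
     alg_mult = (\<lambda>A B. \<Union>a\<in>A. \<Union>b\<in>B. lpa_rel E `` {Mult a b}),
     alg_star = (\<lambda>A. \<Union>a\<in>A. lpa_rel E `` {star_term a}) \<rparr>"

definition lpa_vertex :: "('v, 'e) pre_digraph \<Rightarrow> 'v \<Rightarrow> ('v, 'e) lpa_term set" where
  "lpa_vertex E v = lpa_rel E `` {Vertex v}"

definition lpa_edge :: "('v, 'e) pre_digraph \<Rightarrow> 'e \<Rightarrow> ('v, 'e) lpa_term set" where
  "lpa_edge E e = lpa_rel E `` {Edge e}"

section \<open>Graph C*-algebras\<close>

type_synonym ('v, 'e) operator_family = "('v \<Rightarrow> ell2 \<Rightarrow> ell2) \<times> ('e \<Rightarrow> ell2 \<Rightarrow> ell2)"

definition ck_families :: "('v, 'e) pre_digraph \<Rightarrow> ('v, 'e) operator_family set" where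
  "ck_families E = {(P, S).
     (\<forall>v\<in>verts E. projection (P v)) \<and>
     (\<forall>v\<in>verts E. \<forall>w\<in>verts E. v \<noteq> w \<longrightarrow> P v \<circ> P w = (\<lambda>_. 0)) \<and>
     (\<forall>e\<in>arcs E. partial_isometry (S e)) \<and>
     (\<forall>e\<in>arcs E. \<forall>f\<in>arcs E. e \<noteq> f \<longrightarrow> adjoint (S e) \<circ> S f = (\<lambda>_. 0)) \<and>
     (\<forall>e\<in>arcs E. adjoint (S e) \<circ> S e = P (head E e)) \<and>
     (\<forall>e\<in>arcs E. operator_le (S e \<circ> adjoint (S e)) (P (tail E e))) \<and>
     (\<forall>v. regular_vertex E v \<longrightarrow> P v = (\<lambda>x. \<Sum>e\<in>out_arcs E v. S e (adjoint (S e) x)))}"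

primrec term_operator :: "('v, 'e) operator_family \<Rightarrow> ('v, 'e) lpa_term \<Rightarrow> ell2 \<Rightarrow> ell2" where
  "term_operator \<rho> (Vertex v) = fst \<rho> v"
| "term_operator \<rho> (Edge e) = snd \<rho> e"
| "term_operator \<rho> (Ghost e) = adjoint (snd \<rho> e)"
| "term_operator \<rho> Zero = (\<lambda>_. 0)"
| "term_operator \<rho> (Add a b) = (\<lambda>x. term_operator \<rho> a x + term_operator \<rho> b x)"
| "term_operator \<rho> (Scale k a) = (\<lambda>x. cscale k (term_operator \<rho> a x))"
| "term_operator \<rho> (Mult a b) = term_operator \<rho> a \<circ> term_operator \<rho> b"

text \<open>
  The universal C*-algebra of the generators and relations is realised in the usual way, in the
  product of all representations: it is the closed star-subalgebra of the bounded functions on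
  \<^term>\<open>ck_families E\<close> with values in the bounded operators on \<^typ>\<open>ell2\<close> that is generated by
  the functions \<open>\<rho> \<mapsto> \<rho>(p\<^sub>v)\<close> and \<open>\<rho> \<mapsto> \<rho>(s\<^sub>e)\<close>, with the supremum norm.  The single Hilbert space
  \<^typ>\<open>ell2\<close> suffices: as the graph is countable, a family of operators (or of elements of any
  C*-algebra) satisfying the relations generates a separable C*-algebra, and that has a faithful,
  possibly degenerate, representation on \<^typ>\<open>ell2\<close>.
\<close>

definition graph_cstar_algebra ::
  "('v, 'e) pre_digraph \<Rightarrow> (('v, 'e) operator_family \<Rightarrow> ell2 \<Rightarrow> ell2) normed_star_algebra" where
  "graph_cstar_algebra E = \<lparr>
     alg_carrier = {a \<in> ck_families E \<rightarrow>\<^sub>E Collect bounded_operator.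
       \<forall>\<epsilon>>0. \<exists>t\<in>lpa_terms E. \<forall>\<rho>\<in>ck_families E. onorm (\<lambda>x. a \<rho> x - term_operator \<rho> t x) \<le> \<epsilon>},
     alg_add = (\<lambda>a b. \<lambda>\<rho>\<in>ck_families E. \<lambda>x. a \<rho> x + b \<rho> x),
     alg_scale = (\<lambda>k a. \<lambda>\<rho>\<in>ck_families E. \<lambda>x. cscale k (a \<rho> x)),
     alg_mult = (\<lambda>a b. \<lambda>\<rho>\<in>ck_families E. a \<rho> \<circ> b \<rho>),
     alg_star = (\<lambda>a. \<lambda>\<rho>\<in>ck_families E. adjoint (a \<rho>)),
     alg_norm = (\<lambda>a. SUP \<rho>\<in>ck_families E. onorm (a \<rho>)) \<rparr>"

text \<open>
  The canonical map from the Leavitt path algebra to the graph C*-algebra.  Congruent expressions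
  have the same value on a family in \<^term>\<open>ck_families E\<close>, so the image is a singleton.
\<close>

definition lpa_embedding ::
  "('v, 'e) pre_digraph \<Rightarrow> ('v, 'e) lpa_term set \<Rightarrow> ('v, 'e) operator_family \<Rightarrow> ell2 \<Rightarrow> ell2" where
  "lpa_embedding E A = (\<lambda>\<rho>\<in>ck_families E. the_elem (term_operator \<rho> ` A))"

definition lpa_norm :: "('v, 'e) pre_digraph \<Rightarrow> ('v, 'e) lpa_term set \<Rightarrow> real" where
  "lpa_norm E A = alg_norm (graph_cstar_algebra E) (lpa_embedding E A)"

end

theory Submission
  imports Defs
begin

text \<open>
  A contractive idempotent on a Hilbert space is self-adjoint, and two contractions \<open>A\<close>, \<open>B\<close> with
  \<open>A B A = A\<close> and \<open>B A B = B\<close> are adjoint to each other.  Hence in every representation of the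
  target the norm conditions make the images of the vertices self-adjoint (a vertex that is not a
  source is of the form \<open>e\<^sup>* e\<close>) and the image of \<open>e\<^sup>*\<close> adjoint to that of \<open>e\<close>.  This lifts from
  operators to the Leavitt path algebra because the canonical map into the graph C*-algebra is
  injective: one representation on boundary paths, graded by an integer to encode the gauge
  action, is already faithful.
\<close>

section \<open>Operators on the sequence space\<close>

text \<open>Nothing is assumed about the continuity of \<open>\<psi>\<close>, so it is not extended
  to the C*-algebras. Instead each \<open>\<rho>\<close> in \<open>ck_families F\<close> is composed
  with \<open>\<psi>\<close>, which gives operators on one Hilbert space. As the norm is a supremum
  over all \<open>\<rho>\<close>, the two conditions say that the images of certain generators are
  contractions there, and compatibility with adjoints spreads from generators to all terms by
  induction. The price is the way back: equality under every \<open>\<rho>\<close> has to imply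
  equality modulo the relations of \<open>F\<close>, for every countable graph, cycles without exit
  included. The integer degree replaces averaging over the gauge action: it turns linear
  independence of paths into a comparison of basis vectors. A further obstacle is that
  \<open>adjoint\<close> is a choice operator, so its existence on \<open>ell2\<close> has to be
  established; this is done in coordinates.\<close>

declare zero_ell2.rep_eq [simp] plus_ell2.rep_eq [simp] minus_ell2.rep_eq [simp]
  uminus_ell2.rep_eq [simp] scaleR_ell2.rep_eq [simp] cscale.rep_eq [simp]

lemma ell2_eqI: "(\<And>n. ell2_nth x n = ell2_nth y n) \<Longrightarrow> x = y"
  by (metis ext ell2_nth_inject)

lemma ell2_nth_sum: "ell2_nth (\<Sum>i\<in>A. f i) n = (\<Sum>i\<in>A. ell2_nth (f i) n)"
  by (induction A rule: infinite_finite_induct) simp_all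

lemma ell2_nth_summable: "summable (\<lambda>n. (cmod (ell2_nth x n))\<^sup>2)"
  using ell2_nth by blast

lemma norm_ell2_sq: "(norm x)\<^sup>2 = (\<Sum>n. (cmod (ell2_nth x n))\<^sup>2)"
  by (simp add: power2_norm_eq_inner inner_ell2.rep_eq)

lemma cscale_add_right: "cscale c (x + y) = cscale c x + cscale c y"
  by (rule ell2_eqI) (simp add: algebra_simps)

lemma cscale_add_left: "cscale (c + d) x = cscale c x + cscale d x"
  by (rule ell2_eqI) (simp add: algebra_simps)

lemma cscale_scaleR: "cscale c (r *\<^sub>R x) = r *\<^sub>R cscale c x"
  by (rule ell2_eqI) (simp add: algebra_simps)

lemma cscale_cscale [simp]: "cscale c (cscale d x) = cscale (c * d) x"
  by (rule ell2_eqI) (simp add: algebra_simps)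

lemma cscale_1 [simp]: "cscale 1 x = x"
  by (rule ell2_eqI) simp

lemma cscale_0 [simp]: "cscale 0 x = 0" "cscale c 0 = 0"
  by (rule ell2_eqI, simp)+

lemma cscale_minus1 [simp]: "cscale (- 1) x = - x"
  by (rule ell2_eqI) simp

lemma inner_cscale_left: "cscale c x \<bullet> y = x \<bullet> cscale (cnj c) y"
  unfolding inner_ell2.rep_eq
  by (rule arg_cong[where f = suminf]) (auto simp: inner_complex_def algebra_simps)

lemma norm_cscale [simp]: "norm (cscale c x) = cmod c * norm x"
proof -
  have "(norm (cscale c x))\<^sup>2 = (cmod c * norm x)\<^sup>2"
    by (simp add: norm_ell2_sq norm_mult power_mult_distrib suminf_mult[OF ell2_nth_summable])
  then show ?thesis by (simp add: power2_eq_iff_nonneg)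
qed

section \<open>Truncation and the existence of adjoints\<close>

lift_definition ket :: "nat \<Rightarrow> ell2" is "\<lambda>m n. if n = m then 1 else 0"
  subgoal for m by (rule summable_finite[of "{m}"]) auto
  done

declare ket.rep_eq [simp]

lift_definition truncate_ell2 :: "nat \<Rightarrow> ell2 \<Rightarrow> ell2" is "\<lambda>N x n. if n < N then x n else 0"
  subgoal for N x by (rule summable_finite[of "{..<N}"]) auto
  done

declare truncate_ell2.rep_eq [simp]

lemma truncate_ell2_eq_sum: "truncate_ell2 N x = (\<Sum>n<N. cscale (ell2_nth x n) (ket n))"
proof (rule ell2_eqI)
  fix k
  have "(\<Sum>n<N. ell2_nth x n * (if k = n then 1 else 0)) = (if k < N then ell2_nth x k else 0)"
    by (simp add: if_distrib cong: if_cong)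
  then show "ell2_nth (truncate_ell2 N x) k = ell2_nth (\<Sum>n<N. cscale (ell2_nth x n) (ket n)) k"
    by (simp add: ell2_nth_sum)
qed

lemma truncate_ell2_tendsto: "(\<lambda>N. truncate_ell2 N x) \<longlonglongrightarrow> x"
proof -
  let ?g = "\<lambda>n. (cmod (ell2_nth x n))\<^sup>2"
  have s: "summable ?g" by (rule ell2_nth_summable)
  have eq: "(norm (truncate_ell2 N x - x))\<^sup>2 = suminf ?g - (\<Sum>n<N. ?g n)" for N
  proof -
    have "(norm (truncate_ell2 N x - x))\<^sup>2 = (\<Sum>n. ?g n - (if n < N then ?g n else 0))"
      unfolding norm_ell2_sq by (rule arg_cong[where f = suminf]) auto
    also have "\<dots> = suminf ?g - (\<Sum>n. if n < N then ?g n else 0)"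
      by (rule suminf_diff[symmetric, OF s]) (rule summable_finite[of "{..<N}"], auto)
    also have "(\<Sum>n. if n < N then ?g n else 0) = (\<Sum>n<N. ?g n)"
      by (subst suminf_finite[of "{..<N}"]) auto
    finally show ?thesis .
  qed
  have "(\<lambda>N. suminf ?g - (\<Sum>n<N. ?g n)) \<longlonglongrightarrow> suminf ?g - suminf ?g"
    by (intro tendsto_intros summable_LIMSEQ s)
  then have "(\<lambda>N. sqrt ((norm (truncate_ell2 N x - x))\<^sup>2)) \<longlonglongrightarrow> sqrt 0"
    by (intro tendsto_real_sqrt) (simp add: eq)
  then have "(\<lambda>N. norm (truncate_ell2 N x - x)) \<longlonglongrightarrow> 0" by simp
  then show ?thesis by (simp add: LIM_zero_iff tendsto_norm_zero_iff)
qed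

text \<open>The coordinates of \<open>z\<close> are forced by testing on basis vectors. Boundedness
  of \<open>T\<close> makes them square-summable, and continuity extends the identity from
  truncations to all \<open>x\<close>.\<close>

lemma ell2_adjoint_exists:
  fixes T :: "ell2 \<Rightarrow> ell2"
  assumes T: "bounded_linear T"
  shows "\<exists>z. \<forall>x. T x \<bullet> y = x \<bullet> z"
proof -
  interpret bounded_linear T by (rule T)
  \<comment> \<open>The inner product is real, so a complex coordinate takes two tests, on
    \<open>ket n\<close> and on its multiple by \<open>\<i>\<close>.\<close>
  define c where "c n = Complex (T (ket n) \<bullet> y) (T (cscale \<i> (ket n)) \<bullet> y)" for n
  have coord: "T (cscale a (ket n)) \<bullet> y = a \<bullet> c n" for a n
  proof -
    have "cscale a (ket n) = Re a *\<^sub>R ket n + Im a *\<^sub>R cscale \<i> (ket n)"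
      by (rule ell2_eqI) (auto simp: complex_eq_iff)
    then show ?thesis by (simp add: add scaleR inner_add_left inner_complex_def c_def)
  qed
  have trunc: "T (truncate_ell2 N x) \<bullet> y = (\<Sum>n<N. ell2_nth x n \<bullet> c n)" for N x
    by (simp add: truncate_ell2_eq_sum sum inner_sum_left coord)
  have fin: "summable (\<lambda>n. (cmod (if n < N then c n else 0))\<^sup>2)" for N
    by (rule summable_finite[of "{..<N}"]) auto
  define zN where "zN N = Abs_ell2 (\<lambda>n. if n < N then c n else 0)" for N
  have zN: "ell2_nth (zN N) n = (if n < N then c n else 0)" for N n
    unfolding zN_def using fin[of N] by (subst Abs_ell2_inverse) auto
  \<comment> \<open>\<open>T\<close> is tested on the truncation \<open>zN N\<close> of the wanted
    vector itself: its squared norm equals \<open>T (zN N) \<bullet> y\<close>, which is at most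
    \<open>onorm T * norm (zN N) * norm y\<close>, and one factor \<open>norm (zN N)\<close>
    cancels.\<close>
  have bound: "(\<Sum>n<N. (cmod (c n))\<^sup>2) \<le> (onorm T * norm y)\<^sup>2" for N
  proof -
    have "truncate_ell2 N (zN N) = zN N" by (rule ell2_eqI) (simp add: zN)
    then have 1: "T (zN N) \<bullet> y = (\<Sum>n<N. (cmod (c n))\<^sup>2)"
      using trunc[of N "zN N"] by (simp add: zN dot_square_norm)
    have 2: "(norm (zN N))\<^sup>2 = (\<Sum>n<N. (cmod (c n))\<^sup>2)"
      unfolding norm_ell2_sq by (subst suminf_finite[of "{..<N}"]) (auto simp: zN)
    have "(norm (zN N))\<^sup>2 \<le> norm (T (zN N)) * norm y"
      using 1 2 norm_cauchy_schwarz by metis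
    also have "\<dots> \<le> onorm T * norm (zN N) * norm y"
      by (intro mult_right_mono onorm[OF T]) simp
    finally have "norm (zN N) * norm (zN N) \<le> (onorm T * norm y) * norm (zN N)"
      by (simp add: power2_eq_square mult_ac)
    then have "norm (zN N) \<le> onorm T * norm y"
      using onorm_pos_le[OF T] by (cases "zN N = 0") (auto dest: mult_right_le_imp_le)
    then show ?thesis using 2 by (metis norm_ge_zero power_mono)
  qed
  have "summable (\<lambda>n. (cmod (c n))\<^sup>2)"
    using bound by (rule summableI_nonneg_bounded[rotated]) simp
  then have z: "ell2_nth (Abs_ell2 c) = c" by (simp add: Abs_ell2_inverse)
  have "T x \<bullet> y = x \<bullet> Abs_ell2 c" for x
  proof (rule LIMSEQ_unique)
    show "(\<lambda>N. T (truncate_ell2 N x) \<bullet> y) \<longlonglongrightarrow> T x \<bullet> y"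
      by (intro tendsto_intros bounded_linear.tendsto[OF T] truncate_ell2_tendsto)
    have "(\<lambda>N. \<Sum>n<N. ell2_nth x n \<bullet> c n) \<longlonglongrightarrow> (\<Sum>n. ell2_nth x n \<bullet> c n)"
      by (rule summable_LIMSEQ, rule summable_ell2_inner)
        (use ell2_nth_summable \<open>summable (\<lambda>n. (cmod (c n))\<^sup>2)\<close> in auto)
    then show "(\<lambda>N. T (truncate_ell2 N x) \<bullet> y) \<longlonglongrightarrow> x \<bullet> Abs_ell2 c"
      by (simp only: trunc inner_ell2.rep_eq[of x] z)
  qed
  then show ?thesis by blast
qed

lemma inner_adjoint:
  fixes T :: "ell2 \<Rightarrow> ell2"
  assumes "bounded_linear T"
  shows "x \<bullet> adjoint T y = T x \<bullet> y" "adjoint T y \<bullet> x = y \<bullet> T x"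
proof -
  obtain g where "\<forall>x y. T x \<bullet> y = x \<bullet> g y"
    using ell2_adjoint_exists[OF assms] by metis
  then show "x \<bullet> adjoint T y = T x \<bullet> y" by (metis adjoint_unique)
  then show "adjoint T y \<bullet> x = y \<bullet> T x" by (simp add: inner_commute)
qed

lemma eq_by_inner:
  fixes x y :: "'a :: real_inner"
  assumes "\<And>z. z \<bullet> x = z \<bullet> y" shows "x = y"
  using assms[of "x - y"] by (metis inner_diff_right inner_eq_zero_iff right_minus_eq)

lemma norm_sq_le_imp_norm_le:
  fixes a b :: real
  assumes "a * a \<le> b * a" "0 \<le> a" "0 \<le> b" shows "a \<le> b"
  using assms by (cases "a = 0") (auto dest: mult_right_le_imp_le)

section \<open>Bounded operators and their adjoints\<close>

lemma bounded_operatorD: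
  assumes "bounded_operator T"
  shows "bounded_linear T" "T (x + y) = T x + T y" "T (x - y) = T x - T y" "T 0 = 0"
    "T (cscale c x) = cscale c (T x)"
proof -
  show b: "bounded_linear T" and "T (cscale c x) = cscale c (T x)"
    using assms by (auto simp: bounded_operator_def)
  interpret bounded_linear T by (rule b)
  show "T (x + y) = T x + T y" "T (x - y) = T x - T y" "T 0 = 0"
    by (simp_all add: add diff zero)
qed

lemma norm_adjoint_le:
  fixes T :: "ell2 \<Rightarrow> ell2"
  assumes T: "bounded_linear T"
  shows "norm (adjoint T y) \<le> onorm T * norm y"
proof (rule norm_sq_le_imp_norm_le)
  have "norm (adjoint T y) * norm (adjoint T y) = T (adjoint T y) \<bullet> y"
    by (simp add: inner_adjoint(1)[OF T, symmetric] power2_norm_eq_inner[symmetric] power2_eq_square)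
  also have "\<dots> \<le> norm (T (adjoint T y)) * norm y" by (rule norm_cauchy_schwarz)
  also have "\<dots> \<le> onorm T * norm (adjoint T y) * norm y"
    by (intro mult_right_mono onorm[OF T]) simp
  finally show "norm (adjoint T y) * norm (adjoint T y) \<le> onorm T * norm y * norm (adjoint T y)"
    by (simp add: mult_ac)
qed (use onorm_pos_le[OF T] in auto)

lemma bounded_operator_adjoint:
  assumes "bounded_operator T"
  shows "bounded_operator (adjoint T)"
  unfolding bounded_operator_def
proof (intro conjI allI)
  note T = bounded_operatorD[OF assms]
  note adj = inner_adjoint[OF T(1)]
  show "bounded_linear (adjoint T)"
  proof (rule bounded_linear_intro)
    show "adjoint T (x + y) = adjoint T x + adjoint T y" for x y
      by (rule eq_by_inner) (simp add: adj inner_add_right)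
    show "adjoint T (r *\<^sub>R x) = r *\<^sub>R adjoint T x" for r x
      by (rule eq_by_inner) (simp add: adj)
    show "norm (adjoint T x) \<le> norm x * onorm T" for x
      using norm_adjoint_le[OF T(1)] by (simp add: mult_ac)
  qed
  show "adjoint T (cscale c x) = cscale c (adjoint T x)" for c x
  proof (rule eq_by_inner)
    fix z
    have "z \<bullet> cscale c (adjoint T x) = cscale (cnj c) z \<bullet> adjoint T x"
      by (simp add: inner_cscale_left)
    also have "\<dots> = T z \<bullet> cscale c x" by (simp add: adj T(5) inner_cscale_left)
    finally show "z \<bullet> adjoint T (cscale c x) = z \<bullet> cscale c (adjoint T x)"
      by (simp add: adj)
  qed
qed

lemma bounded_operator_zero: "bounded_operator (\<lambda>_. 0)"
  by (simp add: bounded_operator_def)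

lemma bounded_operator_add:
  "bounded_operator T \<Longrightarrow> bounded_operator U \<Longrightarrow> bounded_operator (\<lambda>x. T x + U x)"
  by (auto simp: bounded_operator_def cscale_add_right intro: bounded_linear_add)

lemma bounded_linear_cscale: "bounded_linear (cscale c)"
  by (rule bounded_linear_intro[of _ "cmod c"])
    (simp_all add: cscale_add_right cscale_scaleR)

lemma bounded_operator_cscale:
  "bounded_operator T \<Longrightarrow> bounded_operator (\<lambda>x. cscale c (T x))"
  by (auto simp: bounded_operator_def mult_ac intro: bounded_linear_compose bounded_linear_cscale)

lemma bounded_operator_comp:
  "bounded_operator T \<Longrightarrow> bounded_operator U \<Longrightarrow> bounded_operator (\<lambda>x. T (U x))"
  by (auto simp: bounded_operator_def intro: bounded_linear_compose)

lemma adjoint_eqI: "(\<And>x y. T x \<bullet> y = x \<bullet> U y) \<Longrightarrow> adjoint T = U"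
  by (rule adjoint_unique) simp

lemma adjoint_adjoint_ell2: "bounded_operator T \<Longrightarrow> adjoint (adjoint T) = T"
  by (rule adjoint_eqI) (simp add: inner_adjoint bounded_operatorD(1))

lemma adjoint_comp:
  "bounded_operator T \<Longrightarrow> bounded_operator U \<Longrightarrow>
    adjoint (\<lambda>x. T (U x)) = (\<lambda>x. adjoint U (adjoint T x))"
  by (rule adjoint_eqI) (simp add: inner_adjoint bounded_operatorD(1))

lemma adjoint_add:
  "bounded_operator T \<Longrightarrow> bounded_operator U \<Longrightarrow>
    adjoint (\<lambda>x. T x + U x) = (\<lambda>x. adjoint T x + adjoint U x)"
  by (rule adjoint_eqI) (simp add: inner_adjoint bounded_operatorD(1) inner_simps)

lemma adjoint_cscale:
  "bounded_operator T \<Longrightarrow> adjoint (\<lambda>x. cscale c (T x)) = (\<lambda>x. cscale (cnj c) (adjoint T x))"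
  by (rule adjoint_eqI)
    (simp add: inner_cscale_left inner_adjoint(1)[symmetric] bounded_operatorD
      bounded_operator_adjoint)

lemma adjoint_zero: "adjoint (\<lambda>_. 0 :: ell2) = (\<lambda>_. 0 :: ell2)"
  by (rule adjoint_eqI) simp

section \<open>Contractions, idempotents and adjoints\<close>

lemma onorm_le_1_iff:
  assumes "bounded_linear T"
  shows "onorm T \<le> 1 \<longleftrightarrow> (\<forall>x. norm (T x) \<le> norm x)"
proof
  assume "onorm T \<le> 1"
  then show "\<forall>x. norm (T x) \<le> norm x"
    using onorm[OF assms] by (metis mult_left_le_one_le norm_ge_zero onorm_pos_le[OF assms] order_trans)
next
  assume "\<forall>x. norm (T x) \<le> norm x"
  then show "onorm T \<le> 1" by (intro onorm_bound) auto
qed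

text \<open>
  For \<open>u\<close> in the range and \<open>k\<close> in the kernel of the idempotent,
  \<open>\<parallel>u\<parallel> \<le> \<parallel>u + t k\<parallel>\<close> for all real \<open>t\<close>, so the range is orthogonal to the kernel.
\<close>

lemma contractive_idempotent_selfadjoint:
  fixes Q :: "'a::real_inner \<Rightarrow> 'a"
  assumes Q: "linear Q" and idem: "\<And>x. Q (Q x) = Q x" and contr: "\<And>x. norm (Q x) \<le> norm x"
  shows "Q x \<bullet> y = x \<bullet> Q y"
proof -
  interpret linear Q by (rule Q)
  have orth: "u \<bullet> k = 0" if u: "Q u = u" and k: "Q k = 0" for u k
  proof (cases "k = 0")
    case False
    \<comment> \<open>This \<open>t\<close> minimises the quadratic function \<open>t \<mapsto> (u +
      t *\<^sub>R k) \<bullet> (u + t *\<^sub>R k)\<close>.\<close>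
    define t where "t = - (u \<bullet> k) / (k \<bullet> k)"
    have kk: "k \<bullet> k > 0" using False by simp
    have "norm u \<le> norm (u + t *\<^sub>R k)"
      using contr[of "u + t *\<^sub>R k"] by (simp add: add scale u k)
    then have "u \<bullet> u \<le> (u + t *\<^sub>R k) \<bullet> (u + t *\<^sub>R k)"
      by (simp add: norm_le)
    also have "\<dots> = u \<bullet> u + 2 * t * (u \<bullet> k) + t * t * (k \<bullet> k)"
      by (simp add: inner_simps inner_commute algebra_simps)
    also have "\<dots> = u \<bullet> u - (u \<bullet> k)\<^sup>2 / (k \<bullet> k)"
      using kk by (simp add: t_def field_simps power2_eq_square)
    finally have "(u \<bullet> k)\<^sup>2 / (k \<bullet> k) \<le> 0" by simp
    then have "(u \<bullet> k)\<^sup>2 \<le> 0" using kk by (simp add: divide_le_0_iff)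
    then show ?thesis by simp
  qed simp
  have "Q a \<bullet> b = Q a \<bullet> Q b" for a b
    using orth[of "Q a" "b - Q b"] by (simp add: idem diff inner_diff_right)
  then show ?thesis by (metis inner_commute)
qed

text \<open>
  The idempotent \<open>B A\<close> is a projection \<open>P\<close>, and the contractions \<open>A\<close>, \<open>B\<close> make \<open>A\<close> isometric on
  its range, so \<open>A\<^sup>* A = P\<close>; the contractive idempotent \<open>A B\<close> is self-adjoint as well, whence
  \<open>B = P B = A\<^sup>* A B = (A B A)\<^sup>* = A\<^sup>*\<close>.
\<close>

lemma contractive_inverse_eq_adjoint:
  fixes A B P :: "'a::real_inner \<Rightarrow> 'a"
  assumes A: "linear A" and B: "linear B"
    and cA: "\<And>x. norm (A x) \<le> norm x" and cB: "\<And>x. norm (B x) \<le> norm x"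
    and BA: "\<And>x. B (A x) = P x" and AP: "\<And>x. A (P x) = A x" and PB: "\<And>x. P (B x) = B x"
  shows "A x \<bullet> y = x \<bullet> B y"
proof -
  interpret A: linear A by (rule A)
  interpret B: linear B by (rule B)
  have cP: "norm (P x) \<le> norm x" for x
    using cA cB BA order_trans by metis
  have P: "linear P"
    by (rule linearI) (simp_all add: BA[symmetric] A.add B.add A.scale B.scale)
  have Psa: "P x \<bullet> y = x \<bullet> P y" for x y
    by (rule contractive_idempotent_selfadjoint[OF P _ cP]) (metis AP BA)
  have Qsa: "A (B x) \<bullet> y = x \<bullet> A (B y)" for x y
  proof (rule contractive_idempotent_selfadjoint[where Q = "\<lambda>x. A (B x)"])
    show "linear (\<lambda>x. A (B x))"
      by (rule linearI) (simp_all add: A.add B.add A.scale B.scale)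
    show "A (B (A (B x))) = A (B x)" for x by (simp add: BA PB)
    show "norm (A (B x)) \<le> norm x" for x using cA cB order_trans by blast
  qed
  have iso: "norm (A x) = norm (P x)" for x
  proof (rule antisym)
    show "norm (A x) \<le> norm (P x)" using cA[of "P x"] by (simp add: AP)
    show "norm (P x) \<le> norm (A x)" using cB[of "A x"] by (simp add: BA)
  qed
  interpret P: linear P by (rule P)
  \<comment> \<open>Polarisation; as the inner product is real, the norms at \<open>u\<close>,
    \<open>v\<close> and \<open>u + v\<close> determine it.\<close>
  have polar: "A u \<bullet> A v = P u \<bullet> P v" for u v
    using iso[of "u + v"] iso[of u] iso[of v]
    by (simp add: A.add P.add norm_eq inner_simps inner_commute)
  have "x \<bullet> B y = P x \<bullet> P (B y)" by (metis PB Psa)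
  also have "\<dots> = A x \<bullet> A (B y)" by (rule polar[symmetric])
  also have "\<dots> = A (B (A x)) \<bullet> y" by (rule Qsa[symmetric])
  also have "\<dots> = A x \<bullet> y" by (simp add: BA AP)
  finally show ?thesis by simp
qed

section \<open>Representations of Leavitt path algebras\<close>

lemma selfadjoint_idempotent_contractive:
  fixes P :: "'a::real_inner \<Rightarrow> 'a"
  assumes "\<And>x y. P x \<bullet> y = x \<bullet> P y" "\<And>x. P (P x) = P x"
  shows "norm (P x) \<le> norm x"
proof (rule norm_sq_le_imp_norm_le)
  have "norm (P x) * norm (P x) = P x \<bullet> P x" by (simp add: dot_square_norm power2_eq_square)
  also have "\<dots> = x \<bullet> P x" by (metis assms)
  also have "\<dots> \<le> norm x * norm (P x)" by (rule norm_cauchy_schwarz)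
  finally show "norm (P x) * norm (P x) \<le> norm x * norm (P x)" .
qed auto

text \<open>Bounds an edge operator, for which only the product with its adjoint is known: that
  product is the vertex projection at the range of the edge.\<close>

lemma contractive_adjoint_comp_imp_contractive:
  fixes T :: "ell2 \<Rightarrow> ell2"
  assumes T: "bounded_linear T" and c: "\<And>x. norm (adjoint T (T x)) \<le> norm x"
  shows "norm (T x) \<le> norm x"
proof -
  have "(norm (T x))\<^sup>2 = x \<bullet> adjoint T (T x)"
    by (simp add: dot_square_norm inner_adjoint(1)[OF T])
  also have "\<dots> \<le> norm x * norm (adjoint T (T x))" by (rule norm_cauchy_schwarz)
  also have "\<dots> \<le> norm x * norm x" by (intro mult_left_mono c) auto
  finally have "(norm (T x))\<^sup>2 \<le> (norm x)\<^sup>2" by (simp add: power2_eq_square)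
  then show ?thesis by (rule power2_le_imp_le) simp
qed

lemma contractive_adjoint:
  fixes T :: "ell2 \<Rightarrow> ell2"
  assumes T: "bounded_linear T" and c: "\<And>x. norm (T x) \<le> norm x"
  shows "norm (adjoint T x) \<le> norm x"
proof -
  have "onorm T \<le> 1" using onorm_le_1_iff[OF T] c by blast
  then have "onorm T * norm x \<le> 1 * norm x" by (intro mult_right_mono) auto
  then show ?thesis using norm_adjoint_le[OF T, of x] by simp
qed

lemma projectionD:
  assumes "projection P"
  shows "bounded_operator P" "P (P x) = P x" "adjoint P = P" "P x \<bullet> y = x \<bullet> P y"
    "norm (P x) \<le> norm x"
proof -
  show b: "bounded_operator P" and i: "P (P x) = P x" and a: "adjoint P = P" for x
    using assms by (auto simp: projection_def fun_eq_iff)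
  show s: "P x \<bullet> y = x \<bullet> P y" for x y
    by (metis a inner_adjoint(1) b bounded_operatorD(1))
  show "norm (P x) \<le> norm x"
    using selfadjoint_idempotent_contractive[of P] s i by blast
qed

section \<open>Consequences of the Cuntz-Krieger relations\<close>

lemma ck_familiesD:
  assumes "\<rho> \<in> ck_families E"
  shows "v \<in> verts E \<Longrightarrow> projection (fst \<rho> v)"
    "v \<in> verts E \<Longrightarrow> w \<in> verts E \<Longrightarrow> v \<noteq> w \<Longrightarrow> fst \<rho> v (fst \<rho> w x) = 0"
    "e \<in> arcs E \<Longrightarrow> bounded_operator (snd \<rho> e)"
    "e \<in> arcs E \<Longrightarrow> snd \<rho> e (adjoint (snd \<rho> e) (snd \<rho> e x)) = snd \<rho> e x"
    "e \<in> arcs E \<Longrightarrow> f \<in> arcs E \<Longrightarrow> e \<noteq> f \<Longrightarrow> adjoint (snd \<rho> e) (snd \<rho> f x) = 0"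
    "e \<in> arcs E \<Longrightarrow> adjoint (snd \<rho> e) (snd \<rho> e x) = fst \<rho> (head E e) x"
    "e \<in> arcs E \<Longrightarrow> operator_le (snd \<rho> e \<circ> adjoint (snd \<rho> e)) (fst \<rho> (tail E e))"
    "regular_vertex E v \<Longrightarrow>
      fst \<rho> v x = (\<Sum>e\<in>out_arcs E v. snd \<rho> e (adjoint (snd \<rho> e) x))"
  using assms by (auto simp: ck_families_def partial_isometry_def fun_eq_iff)

text \<open>Keeps the supremum in \<open>lpa_norm\<close> from being taken over the empty
  set.\<close>

lemma zero_in_ck_families: "(\<lambda>_ _. 0, \<lambda>_ _. 0) \<in> ck_families E"
  by (simp add: ck_families_def projection_def partial_isometry_def operator_le_def
      bounded_operator_zero adjoint_zero o_def)

lemma ck_edge_contractive: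
  assumes "wf_digraph E" "\<rho> \<in> ck_families E" "e \<in> arcs E"
  shows "norm (snd \<rho> e x) \<le> norm x"
proof (rule contractive_adjoint_comp_imp_contractive)
  show "norm (adjoint (snd \<rho> e) (snd \<rho> e x)) \<le> norm x" for x
    using assms by (simp add: ck_familiesD(6) projectionD(5) ck_familiesD(1)
        wf_digraph.head_in_verts)
qed (rule bounded_operatorD(1)[OF ck_familiesD(3)[OF assms(2,3)]])

lemma ck_edge_head:
  assumes "wf_digraph E" "\<rho> \<in> ck_families E" "e \<in> arcs E"
  shows "snd \<rho> e (fst \<rho> (head E e) x) = snd \<rho> e x"
  using assms ck_familiesD(4,6)[OF assms(2,3)] by simp

text \<open>A family satisfies only the operator inequality at the source of an edge. On
  \<open>y = snd \<rho> e x\<close> the range projection of the edge acts as the identity, so the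
  inequality reads \<open>y \<bullet> y \<le> ?P y \<bullet> y\<close>, and this forces the
  component of \<open>y\<close> orthogonal to the range of \<open>?P\<close> to vanish.\<close>

lemma ck_edge_tail:
  assumes "wf_digraph E" and \<rho>: "\<rho> \<in> ck_families E" and e: "e \<in> arcs E"
  shows "fst \<rho> (tail E e) (snd \<rho> e x) = snd \<rho> e x"
proof -
  let ?S = "snd \<rho> e" and ?P = "fst \<rho> (tail E e)"
  have P: "projection ?P"
    using assms ck_familiesD(1) wf_digraph.tail_in_verts by metis
  define y where "y = ?S x"
  have "0 \<le> (?P y - ?S (adjoint ?S y)) \<bullet> y"
    using ck_familiesD(7)[OF \<rho> e] by (simp add: operator_le_def)
  then have 1: "y \<bullet> y \<le> ?P y \<bullet> y"
    unfolding y_def ck_familiesD(4)[OF \<rho> e] by (simp add: inner_diff_left)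
  have "(y - ?P y) \<bullet> (y - ?P y) = y \<bullet> y - ?P y \<bullet> y"
    using projectionD(2,4)[OF P] by (simp add: inner_simps inner_commute)
  then have "(y - ?P y) \<bullet> (y - ?P y) \<le> 0" using 1 by simp
  then have "y - ?P y = 0" by (metis inner_eq_zero_iff inner_ge_zero order_antisym)
  then show ?thesis by (simp add: y_def)
qed

lemma ck_ghost_head:
  assumes "wf_digraph E" "\<rho> \<in> ck_families E" "e \<in> arcs E"
  shows "fst \<rho> (head E e) (adjoint (snd \<rho> e) x) = adjoint (snd \<rho> e) x"
proof (rule eq_by_inner)
  fix z
  have P: "projection (fst \<rho> (head E e))"
    using assms ck_familiesD(1) wf_digraph.head_in_verts by metis
  show "z \<bullet> fst \<rho> (head E e) (adjoint (snd \<rho> e) x) = z \<bullet> adjoint (snd \<rho> e) x"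
    using ck_edge_head[OF assms] projectionD(4)[OF P]
      inner_adjoint(1)[OF bounded_operatorD(1)[OF ck_familiesD(3)[OF assms(2,3)]]]
    by metis
qed

lemma ck_ghost_tail:
  assumes "wf_digraph E" "\<rho> \<in> ck_families E" "e \<in> arcs E"
  shows "adjoint (snd \<rho> e) (fst \<rho> (tail E e) x) = adjoint (snd \<rho> e) x"
proof (rule eq_by_inner)
  fix z
  have P: "projection (fst \<rho> (tail E e))"
    using assms ck_familiesD(1) wf_digraph.tail_in_verts by metis
  show "z \<bullet> adjoint (snd \<rho> e) (fst \<rho> (tail E e) x) = z \<bullet> adjoint (snd \<rho> e) x"
    using ck_edge_tail[OF assms] projectionD(4)[OF P]
      inner_adjoint(1)[OF bounded_operatorD(1)[OF ck_familiesD(3)[OF assms(2,3)]]]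
    by metis
qed

text \<open>
  The congruence of two expressions over \<open>E\<close> may pass through expressions that contain vertices
  and edges outside \<open>E\<close>, on which a family is arbitrary, not even linear.  Families are therefore
  first extended by zero.
\<close>

definition zero_extend ::
  "('v, 'e) pre_digraph \<Rightarrow> ('v, 'e) operator_family \<Rightarrow> ('v, 'e) operator_family" where
  "zero_extend E \<rho> = (\<lambda>v. if v \<in> verts E then fst \<rho> v else (\<lambda>_. 0),
     \<lambda>e. if e \<in> arcs E then snd \<rho> e else (\<lambda>_. 0))"

lemma term_operator_zero_extend:
  "t \<in> lpa_terms E \<Longrightarrow> term_operator (zero_extend E \<rho>) t = term_operator \<rho> t"
  by (induction rule: lpa_terms.induct) (simp_all add: zero_extend_def)

lemma zero_extend_in_ck_families:
  assumes "wf_digraph E" "\<rho> \<in> ck_families E"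
  shows "zero_extend E \<rho> \<in> ck_families E"
proof -
  interpret wf_digraph E by (rule assms)
  show ?thesis
    using assms(2) unfolding ck_families_def zero_extend_def
    by (auto simp: regular_vertex_def fun_eq_iff intro!: sum.cong)
qed

lemma bounded_operator_term:
  assumes "\<And>v. bounded_operator (fst \<rho> v)" "\<And>e. bounded_operator (snd \<rho> e)"
  shows "bounded_operator (term_operator \<rho> t)"
  by (induction t) (simp_all add: assms bounded_operator_adjoint bounded_operator_zero
      bounded_operator_add bounded_operator_cscale bounded_operator_comp o_def)

lemma term_operator_foldr:
  "distinct es \<Longrightarrow> term_operator \<rho> (foldr (\<lambda>e. Add (Mult (Edge e) (Ghost e))) es Zero) =
    (\<lambda>x. \<Sum>e\<in>set es. snd \<rho> e (adjoint (snd \<rho> e) x))"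
  by (induction es) auto

lemma bounded_operator_zero_extend:
  assumes "\<rho> \<in> ck_families E"
  shows "bounded_operator (fst (zero_extend E \<rho>) v)" "bounded_operator (snd (zero_extend E \<rho>) e)"
  using assms by (auto simp: zero_extend_def bounded_operator_zero ck_familiesD(3)
      projectionD(1)[OF ck_familiesD(1)])

lemma lpa_cong_imp_zero_extend_eq:
  assumes E: "wf_digraph E" and \<rho>: "\<rho> \<in> ck_families E" and "lpa_cong E a b"
  shows "term_operator (zero_extend E \<rho>) a = term_operator (zero_extend E \<rho>) b"
proof -
  note ck = zero_extend_in_ck_families[OF E \<rho>]
  note b = bounded_operator_term[OF bounded_operator_zero_extend[OF \<rho>], where t = t for t]
  show ?thesis
    using assms(3)
  proof (induction rule: lpa_cong.induct)
    case (regular v es)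
    then show ?case using ck_familiesD(8)[OF ck regular(1)]
      by (simp add: term_operator_foldr fun_eq_iff)
  qed (auto simp: fun_eq_iff ck_edge_head[OF E ck] ck_edge_tail[OF E ck] ck_ghost_head[OF E ck]
      ck_ghost_tail[OF E ck] ck_familiesD(2,5,6)[OF ck] projectionD(2)[OF ck_familiesD(1)[OF ck]]
      bounded_operatorD(2,5)[OF b] cscale_add_right cscale_add_left algebra_simps)
qed

lemma lpa_cong_imp_term_operator_eq:
  assumes "wf_digraph E" "\<rho> \<in> ck_families E" "lpa_cong E a b" "a \<in> lpa_terms E" "b \<in> lpa_terms E"
  shows "term_operator \<rho> a = term_operator \<rho> b"
  using lpa_cong_imp_zero_extend_eq[OF assms(1-3)] assms(4,5)
  by (simp add: term_operator_zero_extend)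

lemma bounded_operator_term_operator:
  assumes "\<rho> \<in> ck_families E" "t \<in> lpa_terms E"
  shows "bounded_operator (term_operator \<rho> t)"
  using bounded_operator_term[OF bounded_operator_zero_extend[OF assms(1)], of t] assms(2)
  by (simp add: term_operator_zero_extend)

lemma term_operator_star_term:
  assumes "\<rho> \<in> ck_families E" "t \<in> lpa_terms E"
  shows "term_operator \<rho> (star_term t) = adjoint (term_operator \<rho> t)"
  using assms(2)
proof induction
  case (1 v)
  then show ?case using assms(1) by (simp add: projectionD(3)[OF ck_familiesD(1)])
next
  case (3 e)
  then show ?case using assms(1) by (simp add: adjoint_adjoint_ell2 ck_familiesD(3))
qed (simp_all add: o_def adjoint_zero adjoint_add adjoint_cscale adjoint_comp
    bounded_operator_term_operator[OF assms(1)])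

text \<open>\<open>C\<close> depends on the term but not on the family, which makes the supremum in
  \<open>lpa_norm\<close> finite. It exists because in every family the generators act as
  contractions.\<close>

lemma term_operator_uniformly_bounded:
  assumes E: "wf_digraph E" and "t \<in> lpa_terms E"
  shows "\<exists>C\<ge>0. \<forall>\<rho>\<in>ck_families E. \<forall>x. norm (term_operator \<rho> t x) \<le> C * norm x"
  using assms(2)
proof induction
  case (1 v)
  then show ?case by (intro exI[of _ 1]) (simp add: projectionD(5)[OF ck_familiesD(1)])
next
  case (2 e)
  then show ?case by (intro exI[of _ 1]) (simp add: ck_edge_contractive[OF E])
next
  case (3 e)
  then show ?case by (intro exI[of _ 1])
      (simp add: contractive_adjoint bounded_operatorD(1) ck_familiesD(3) ck_edge_contractive[OF E])
next
  case 4
  then show ?case by auto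
next
  case (5 a b)
  then obtain C D where *: "C \<ge> 0" "D \<ge> 0"
    "\<forall>\<rho>\<in>ck_families E. \<forall>x. norm (term_operator \<rho> a x) \<le> C * norm x"
    "\<forall>\<rho>\<in>ck_families E. \<forall>x. norm (term_operator \<rho> b x) \<le> D * norm x" by blast
  have "norm (term_operator \<rho> a x + term_operator \<rho> b x) \<le> (C + D) * norm x"
    if "\<rho> \<in> ck_families E" for \<rho> x
    using norm_triangle_mono[of "term_operator \<rho> a x" _ "term_operator \<rho> b x"] *(3,4) that
    by (auto simp: distrib_right)
  then show ?case using *(1,2) by (intro exI[of _ "C + D"]) simp
next
  case (6 a c)
  then obtain C where *: "C \<ge> 0"
    "\<forall>\<rho>\<in>ck_families E. \<forall>x. norm (term_operator \<rho> a x) \<le> C * norm x" by blast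
  then show ?case by (intro exI[of _ "cmod c * C"]) (simp add: mult.assoc mult_left_mono)
next
  case (7 a b)
  then obtain C D where *: "C \<ge> 0" "D \<ge> 0"
    "\<forall>\<rho>\<in>ck_families E. \<forall>x. norm (term_operator \<rho> a x) \<le> C * norm x"
    "\<forall>\<rho>\<in>ck_families E. \<forall>x. norm (term_operator \<rho> b x) \<le> D * norm x" by blast
  have "norm (term_operator \<rho> a (term_operator \<rho> b x)) \<le> C * D * norm x"
    if \<rho>: "\<rho> \<in> ck_families E" for \<rho> x
  proof -
    have "norm (term_operator \<rho> a (term_operator \<rho> b x)) \<le> C * norm (term_operator \<rho> b x)"
      using *(3) \<rho> by blast
    also have "\<dots> \<le> C * (D * norm x)" using *(1,4) \<rho> by (intro mult_left_mono) auto
    finally show ?thesis by (simp add: mult.assoc)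
  qed
  then show ?case using *(1,2) by (intro exI[of _ "C * D"]) simp
qed

section \<open>The quotient algebra\<close>

abbreviation lpa_class :: "('v, 'e) pre_digraph \<Rightarrow> ('v, 'e) lpa_term \<Rightarrow> ('v, 'e) lpa_term set" where
  "lpa_class E t \<equiv> lpa_rel E `` {t}"

lemma equiv_lpa_rel: "equiv (lpa_terms E) (lpa_rel E)"
  by (rule equivI) (auto simp: lpa_rel_def refl_on_def sym_def trans_def
      intro: lpa_cong.refl lpa_cong.sym lpa_cong.trans)

lemma lpa_class_eq_iff:
  "a \<in> lpa_terms E \<Longrightarrow> b \<in> lpa_terms E \<Longrightarrow> lpa_class E a = lpa_class E b \<longleftrightarrow> lpa_cong E a b"
  using eq_equiv_class_iff[OF equiv_lpa_rel] by (auto simp: lpa_rel_def)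

lemma lpa_rel_respects:
  "(\<And>a b. lpa_cong E a b \<Longrightarrow> lpa_cong E (f a) (f b)) \<Longrightarrow>
    (\<And>a. a \<in> lpa_terms E \<Longrightarrow> f a \<in> lpa_terms E) \<Longrightarrow> (\<lambda>a. lpa_class E (f a)) respects lpa_rel E"
  by (rule congruentI, rule lpa_class_eq_iff[THEN iffD2]) (auto simp: lpa_rel_def)

lemma star_term_in_lpa_terms: "t \<in> lpa_terms E \<Longrightarrow> star_term t \<in> lpa_terms E"
  by (induction rule: lpa_terms.induct) (auto intro: lpa_terms.intros)

lemma star_term_foldr:
  "star_term (foldr (\<lambda>e. Add (Mult (Edge e) (Ghost e))) es Zero) =
    foldr (\<lambda>e. Add (Mult (Edge e) (Ghost e))) es Zero"
  by (induction es) auto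

lemma lpa_cong_star_term: "lpa_cong E a b \<Longrightarrow> lpa_cong E (star_term a) (star_term b)"
proof (induction rule: lpa_cong.induct)
  case (regular v es)
  then show ?case by (simp add: star_term_foldr lpa_cong.regular)
qed (auto intro: lpa_cong.intros)

lemma leavitt_path_algebra_class_simps:
  assumes "a \<in> lpa_terms E"
  shows "b \<in> lpa_terms E \<Longrightarrow>
      alg_add (leavitt_path_algebra E) (lpa_class E a) (lpa_class E b) = lpa_class E (Add a b)"
    "b \<in> lpa_terms E \<Longrightarrow>
      alg_mult (leavitt_path_algebra E) (lpa_class E a) (lpa_class E b) = lpa_class E (Mult a b)"
    "alg_scale (leavitt_path_algebra E) k (lpa_class E a) = lpa_class E (Scale k a)"
    "alg_star (leavitt_path_algebra E) (lpa_class E a) = lpa_class E (star_term a)"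
proof -
  note eq = equiv_lpa_rel[of E]
  have c2: "congruent2 (lpa_rel E) (lpa_rel E) (\<lambda>a b. lpa_class E (f a b))"
    if "\<And>a a' b b'. lpa_cong E a a' \<Longrightarrow> lpa_cong E b b' \<Longrightarrow> lpa_cong E (f a b) (f a' b')"
      "\<And>a b. a \<in> lpa_terms E \<Longrightarrow> b \<in> lpa_terms E \<Longrightarrow> f a b \<in> lpa_terms E" for f
    by (rule congruent2I', rule lpa_class_eq_iff[THEN iffD2]) (auto simp: lpa_rel_def that)
  show "alg_add (leavitt_path_algebra E) (lpa_class E a) (lpa_class E b) = lpa_class E (Add a b)"
    if "b \<in> lpa_terms E"
    unfolding leavitt_path_algebra_def star_algebra.simps
    by (rule UN_equiv_class2[OF eq eq c2 assms that]) (auto intro: lpa_cong.intros lpa_terms.intros)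
  show "alg_mult (leavitt_path_algebra E) (lpa_class E a) (lpa_class E b) = lpa_class E (Mult a b)"
    if "b \<in> lpa_terms E"
    unfolding leavitt_path_algebra_def star_algebra.simps
    by (rule UN_equiv_class2[OF eq eq c2 assms that]) (auto intro: lpa_cong.intros lpa_terms.intros)
  show "alg_scale (leavitt_path_algebra E) k (lpa_class E a) = lpa_class E (Scale k a)"
    unfolding leavitt_path_algebra_def star_algebra.simps
    by (rule UN_equiv_class[OF eq lpa_rel_respects assms])
      (auto intro: lpa_cong.intros lpa_terms.intros)
  show "alg_star (leavitt_path_algebra E) (lpa_class E a) = lpa_class E (star_term a)"
    unfolding leavitt_path_algebra_def star_algebra.simps
    by (rule UN_equiv_class[OF eq lpa_rel_respects assms])
      (auto intro: lpa_cong_star_term star_term_in_lpa_terms)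
qed

lemma lpa_class_in_carrier:
  "t \<in> lpa_terms E \<Longrightarrow> lpa_class E t \<in> alg_carrier (leavitt_path_algebra E)"
  by (auto simp: leavitt_path_algebra_def intro: quotientI)

lemma lpa_carrierE:
  assumes "x \<in> alg_carrier (leavitt_path_algebra E)"
  obtains t where "t \<in> lpa_terms E" "x = lpa_class E t"
  using assms by (auto simp: leavitt_path_algebra_def elim: quotientE)

lemma lpa_embedding_class:
  assumes "wf_digraph E" "\<rho> \<in> ck_families E" "t \<in> lpa_terms E"
  shows "lpa_embedding E (lpa_class E t) \<rho> = term_operator \<rho> t"
proof -
  have "term_operator \<rho> ` lpa_class E t = {term_operator \<rho> t}"
    using lpa_cong_imp_term_operator_eq[OF assms(1,2)] assms(3)
    by (auto simp: lpa_rel_def intro: lpa_cong.refl)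
  then show ?thesis using assms(2) by (simp add: lpa_embedding_def)
qed

text \<open>The only place where the C*-norm is unfolded; from here on a norm bound by 1 means
  contractivity in every representation.\<close>

lemma lpa_norm_le_1_iff:
  assumes E: "wf_digraph E" and t: "t \<in> lpa_terms E"
  shows "lpa_norm E (lpa_class E t) \<le> 1 \<longleftrightarrow>
    (\<forall>\<rho>\<in>ck_families E. \<forall>x. norm (term_operator \<rho> t x) \<le> norm x)"
proof -
  have bl: "bounded_linear (term_operator \<rho> t)" if "\<rho> \<in> ck_families E" for \<rho>
    using bounded_operatorD(1)[OF bounded_operator_term_operator[OF that t]] .
  obtain C where C: "C \<ge> 0"
    "\<forall>\<rho>\<in>ck_families E. \<forall>x. norm (term_operator \<rho> t x) \<le> C * norm x"
    using term_operator_uniformly_bounded[OF E t] by blast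
  have bdd: "bdd_above ((\<lambda>\<rho>. onorm (term_operator \<rho> t)) ` ck_families E)"
    using C by (intro bdd_aboveI2[of _ _ C] onorm_bound) auto
  have "lpa_norm E (lpa_class E t) = (SUP \<rho>\<in>ck_families E. onorm (term_operator \<rho> t))"
    by (simp add: lpa_norm_def graph_cstar_algebra_def lpa_embedding_class[OF E _ t])
  then have "lpa_norm E (lpa_class E t) \<le> 1 \<longleftrightarrow>
      (\<forall>\<rho>\<in>ck_families E. onorm (term_operator \<rho> t) \<le> 1)"
    using cSUP_le_iff[OF _ bdd] zero_in_ck_families by (metis empty_iff)
  then show ?thesis by (simp add: onorm_le_1_iff[OF bl])
qed

section \<open>Partial injections of a countable basis\<close>

text \<open>With relations the operator calculus becomes set-theoretic: the adjoint turns into the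
  converse, and composition into \<open>O\<close> in reversed order.\<close>

definition partial_inj :: "('a \<times> 'b) set \<Rightarrow> bool" where
  "partial_inj r \<longleftrightarrow> single_valued r \<and> single_valued (r\<inverse>)"

lemma partial_inj_converse [simp]: "partial_inj (r\<inverse>) \<longleftrightarrow> partial_inj r"
  by (auto simp: partial_inj_def)

lemma partial_inj_relcomp: "partial_inj r \<Longrightarrow> partial_inj s \<Longrightarrow> partial_inj (r O s)"
  by (auto simp: partial_inj_def converse_relcomp intro: single_valued_relcomp)

lemma partial_inj_Id_on [simp]: "partial_inj (Id_on A)"
  by (auto simp: partial_inj_def single_valued_def)

lemma partial_injD:
  "partial_inj r \<Longrightarrow> (m, n) \<in> r \<Longrightarrow> (m, n') \<in> r \<Longrightarrow> n = n'"
  "partial_inj r \<Longrightarrow> (m, n) \<in> r \<Longrightarrow> (m', n) \<in> r \<Longrightarrow> m = m'"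
  by (auto simp: partial_inj_def single_valued_def)

lemma partial_inj_relcomp_converse:
  assumes "partial_inj r"
  shows "r O r\<inverse> = Id_on (Domain r)" "r\<inverse> O r = Id_on (Range r)"
  using partial_injD[OF assms] by (auto simp: Id_on_iff)

text \<open>The guard sends every relation that is not a partial injection to the zero operator, so
  that boundedness holds without a side condition.\<close>

definition transport_seq :: "(nat \<times> nat) set \<Rightarrow> (nat \<Rightarrow> complex) \<Rightarrow> nat \<Rightarrow> complex" where
  "transport_seq r x n = (if partial_inj r \<and> n \<in> Range r then x (THE m. (m, n) \<in> r) else 0)"

lemma transport_seq_eq: "partial_inj r \<Longrightarrow> (m, n) \<in> r \<Longrightarrow> transport_seq r x n = x m"
  by (auto simp: transport_seq_def intro!: arg_cong[where f = x] the_equality dest: partial_injD)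

text \<open>Distinct indices in the range of \<open>r\<close> come from distinct indices, so a
  partial sum of the transported series is a finite sub-sum of the original one.\<close>

lemma sum_transport_seq_le:
  assumes "summable (\<lambda>n. (cmod (x n))\<^sup>2)"
  shows "(\<Sum>n<N. (cmod (transport_seq r x n))\<^sup>2) \<le> (\<Sum>n. (cmod (x n))\<^sup>2)"
proof (cases "partial_inj r")
  case True
  define h where "h n = (THE m. (m, n) \<in> r)" for n
  have h: "(h n, n) \<in> r" if "n \<in> Range r" for n
  proof -
    obtain m where "(m, n) \<in> r" using \<open>n \<in> Range r\<close> by (auto simp: Range_iff)
    moreover from this have "h n = m"
      unfolding h_def by (rule the_equality) (metis partial_injD(2)[OF True] \<open>(m, n) \<in> r\<close>)
    ultimately show ?thesis by simp
  qed
  let ?A = "{..<N} \<inter> Range r"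
  have inj: "inj_on h ?A"
    by (rule inj_onI) (metis IntD2 h partial_injD(1)[OF True])
  have "(\<Sum>n<N. (cmod (transport_seq r x n))\<^sup>2) = (\<Sum>n\<in>?A. (cmod (transport_seq r x n))\<^sup>2)"
    by (rule sum.mono_neutral_right) (auto simp: transport_seq_def)
  also have "\<dots> = (\<Sum>n\<in>?A. (cmod (x (h n)))\<^sup>2)"
    by (intro sum.cong) (auto simp: transport_seq_def True h_def)
  also have "\<dots> = (\<Sum>m\<in>h ` ?A. (cmod (x m))\<^sup>2)"
    by (simp add: sum.reindex[OF inj])
  also have "\<dots> \<le> (\<Sum>n. (cmod (x n))\<^sup>2)"
    by (intro sum_le_suminf assms) auto
  finally show ?thesis .
qed (simp add: transport_seq_def suminf_nonneg assms)

lift_definition transport :: "(nat \<times> nat) set \<Rightarrow> ell2 \<Rightarrow> ell2" is transport_seq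
  by (rule summableI_nonneg_bounded[OF _ sum_transport_seq_le]) auto

lemma ell2_nth_transport:
  "partial_inj r \<Longrightarrow> (m, n) \<in> r \<Longrightarrow> ell2_nth (transport r x) n = ell2_nth x m"
  "n \<notin> Range r \<Longrightarrow> ell2_nth (transport r x) n = 0"
  by (simp_all add: transport.rep_eq transport_seq_eq) (simp add: transport_seq_def)

lemma bounded_operator_transport: "bounded_operator (transport r)"
  unfolding bounded_operator_def
proof (intro conjI allI)
  show "bounded_linear (transport r)"
  proof (rule bounded_linear_intro[where K = 1])
    fix x
    have "(norm (transport r x))\<^sup>2 \<le> (norm x)\<^sup>2"
      unfolding norm_ell2_sq
    proof (rule suminf_le_const)
      show "summable (\<lambda>n. (cmod (ell2_nth (transport r x) n))\<^sup>2)" by (rule ell2_nth_summable)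
      show "(\<Sum>i<n. (cmod (ell2_nth (transport r x) i))\<^sup>2) \<le> (\<Sum>n. (cmod (ell2_nth x n))\<^sup>2)" for n
        unfolding transport.rep_eq by (rule sum_transport_seq_le) (rule ell2_nth_summable)
    qed
    then show "norm (transport r x) \<le> norm x * 1" using power2_le_imp_le[OF _ norm_ge_zero] by simp
  qed (rule ell2_eqI, simp add: transport.rep_eq transport_seq_def)+
  show "transport r (cscale c x) = cscale c (transport r x)" for c x
    by (rule ell2_eqI) (simp add: transport.rep_eq transport_seq_def)
qed

lemma transport_ket:
  assumes "partial_inj r"
  shows "(m, n) \<in> r \<Longrightarrow> transport r (cscale c (ket m)) = cscale c (ket n)"
    "m \<notin> Domain r \<Longrightarrow> transport r (cscale c (ket m)) = 0"
proof -
  have "ell2_nth (transport r (cscale c (ket m))) k = (if (m, k) \<in> r then c else 0)" for k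
  proof (cases "k \<in> Range r")
    case True
    then obtain l where "(l, k) \<in> r" by blast
    then show ?thesis using partial_injD(2)[OF assms] by (auto simp: ell2_nth_transport(1)[OF assms])
  next
    case False
    then show ?thesis by (auto simp: ell2_nth_transport(2))
  qed
  then show "(m, n) \<in> r \<Longrightarrow> transport r (cscale c (ket m)) = cscale c (ket n)"
    "m \<notin> Domain r \<Longrightarrow> transport r (cscale c (ket m)) = 0"
    by (auto intro!: ell2_eqI dest: partial_injD(1)[OF assms])
qed

lemma inner_ket: "x \<bullet> cscale c (ket n) = ell2_nth x n \<bullet> c"
  unfolding inner_ell2.rep_eq by (subst suminf_finite[of "{n}"]) auto

text \<open>Coordinates are compared by pairing with \<open>cscale c (ket n)\<close> for all complex
  \<open>c\<close>, because the real inner product with \<open>ket n\<close> alone would reveal only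
  the real part.\<close>

lemma adjoint_transport:
  assumes "partial_inj r"
  shows "adjoint (transport r) = transport (r\<inverse>)"
proof (intro ext ell2_eqI)
  fix y n
  note b = bounded_operatorD(1)[OF bounded_operator_transport]
  show "ell2_nth (adjoint (transport r) y) n = ell2_nth (transport (r\<inverse>) y) n"
  proof (rule eq_by_inner)
    fix c
    have "c \<bullet> ell2_nth (adjoint (transport r) y) n = y \<bullet> transport r (cscale c (ket n))"
      by (simp add: inner_adjoint(2)[OF b, symmetric] inner_ket inner_commute[of c])
    also have "\<dots> = c \<bullet> ell2_nth (transport (r\<inverse>) y) n"
    proof (cases "n \<in> Domain r")
      case True
      then obtain k where k: "(n, k) \<in> r" by blast
      then have "ell2_nth (transport (r\<inverse>) y) n = ell2_nth y k"
        using assms by (intro ell2_nth_transport(1)) auto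
      then show ?thesis by (simp add: transport_ket(1)[OF assms k] inner_ket inner_commute)
    next
      case False
      then show ?thesis by (simp add: transport_ket(2)[OF assms False] ell2_nth_transport(2))
    qed
    finally show "c \<bullet> ell2_nth (adjoint (transport r) y) n = c \<bullet> ell2_nth (transport (r\<inverse>) y) n" .
  qed
qed

lemma transport_transport:
  assumes r: "partial_inj r" and s: "partial_inj s"
  shows "transport r (transport s x) = transport (s O r) x"
proof (rule ell2_eqI)
  fix n
  consider m k where "(m, k) \<in> s" "(k, n) \<in> r" | k where "(k, n) \<in> r" "k \<notin> Range s"
    | "n \<notin> Range r" by blast
  then show "ell2_nth (transport r (transport s x)) n = ell2_nth (transport (s O r) x) n"
  proof cases
    case (1 m k)
    moreover from 1 have "(m, n) \<in> s O r" by blast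
    ultimately show ?thesis
      using ell2_nth_transport(1)[OF partial_inj_relcomp[OF s r]]
      by (simp add: ell2_nth_transport(1)[OF r] ell2_nth_transport(1)[OF s])
  next
    case (2 k)
    moreover from 2 have "n \<notin> Range (s O r)" by (auto dest: partial_injD(2)[OF r])
    ultimately show ?thesis by (simp add: ell2_nth_transport(1)[OF r] ell2_nth_transport(2))
  next
    case 3
    moreover from 3 have "n \<notin> Range (s O r)" by blast
    ultimately show ?thesis by (simp add: ell2_nth_transport(2))
  qed
qed

lemma transport_empty: "transport {} = (\<lambda>_. 0)"
  by (intro ext ell2_eqI) (simp add: ell2_nth_transport(2))

lemma ell2_nth_transport_Id_on:
  "ell2_nth (transport (Id_on A) x) n = (if n \<in> A then ell2_nth x n else 0)"
  by (auto intro: ell2_nth_transport)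

section \<open>Branching systems\<close>

text \<open>
  The points of \<open>D v\<close> play the role of the boundary paths that start at \<open>v\<close>, and \<open>ext e\<close>
  prefixes a path with the edge \<open>e\<close>.  The map \<open>enc\<close> indexes the standard basis of \<^typ>\<open>ell2\<close>.
\<close>

locale branching_system = wf_digraph E for E :: "('v, 'e) pre_digraph" +
  fixes D :: "'v \<Rightarrow> 'p set" and ext :: "'e \<Rightarrow> 'p \<Rightarrow> 'p" and enc :: "'p \<Rightarrow> nat"
  assumes D_disjoint: "v \<in> verts E \<Longrightarrow> w \<in> verts E \<Longrightarrow> p \<in> D v \<Longrightarrow> p \<in> D w \<Longrightarrow> v = w"
    and ext_in: "e \<in> arcs E \<Longrightarrow> p \<in> D (head E e) \<Longrightarrow> ext e p \<in> D (tail E e)"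
    and ext_inject: "e \<in> arcs E \<Longrightarrow> f \<in> arcs E \<Longrightarrow> p \<in> D (head E e) \<Longrightarrow> q \<in> D (head E f) \<Longrightarrow>
      ext e p = ext f q \<Longrightarrow> e = f \<and> p = q"
    and regular_cover: "regular_vertex E v \<Longrightarrow> p \<in> D v \<Longrightarrow>
      \<exists>e\<in>out_arcs E v. p \<in> ext e ` D (head E e)"
    and enc_inj: "inj_on enc (\<Union>v\<in>verts E. D v)"
begin

lemma enc_eq_iff:
  "v \<in> verts E \<Longrightarrow> w \<in> verts E \<Longrightarrow> p \<in> D v \<Longrightarrow> q \<in> D w \<Longrightarrow> enc p = enc q \<longleftrightarrow> p = q"
  using enc_inj by (auto simp: inj_on_def)

lemma enc_ext_eq_iff:
  assumes "e \<in> arcs E" "f \<in> arcs E" "p \<in> D (head E e)" "q \<in> D (head E f)"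
  shows "enc (ext e p) = enc (ext f q) \<longleftrightarrow> e = f \<and> p = q"
  using assms enc_eq_iff[OF tail_in_verts tail_in_verts ext_in ext_in] ext_inject by blast

lemma enc_head_eq_iff:
  "e \<in> arcs E \<Longrightarrow> p \<in> D (head E e) \<Longrightarrow> q \<in> D (head E e) \<Longrightarrow> enc p = enc q \<longleftrightarrow> p = q"
  using enc_eq_iff[OF head_in_verts head_in_verts] by blast

definition vertex_op :: "'v \<Rightarrow> ell2 \<Rightarrow> ell2" where
  "vertex_op v = transport (Id_on (enc ` D v))"

definition edge_rel :: "'e \<Rightarrow> (nat \<times> nat) set" where
  "edge_rel e = (\<lambda>p. (enc p, enc (ext e p))) ` D (head E e)"

definition edge_op :: "'e \<Rightarrow> ell2 \<Rightarrow> ell2" where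
  "edge_op e = transport (edge_rel e)"

lemma partial_inj_edge_rel: "e \<in> arcs E \<Longrightarrow> partial_inj (edge_rel e)"
  unfolding partial_inj_def single_valued_def edge_rel_def
  by (auto simp: enc_ext_eq_iff enc_head_eq_iff)

lemma edge_rel_relcomp:
  assumes "e \<in> arcs E"
  shows "edge_rel e O (edge_rel e)\<inverse> = Id_on (enc ` D (head E e))"
    "(edge_rel e)\<inverse> O edge_rel e = Id_on (enc ` ext e ` D (head E e))"
proof -
  have "Domain (edge_rel e) = enc ` D (head E e)" "Range (edge_rel e) = enc ` ext e ` D (head E e)"
    by (auto simp: edge_rel_def)
  then show "edge_rel e O (edge_rel e)\<inverse> = Id_on (enc ` D (head E e))"
    "(edge_rel e)\<inverse> O edge_rel e = Id_on (enc ` ext e ` D (head E e))"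
    using partial_inj_relcomp_converse[OF partial_inj_edge_rel[OF assms]] by simp_all
qed

lemma edge_rel_orth:
  "e \<in> arcs E \<Longrightarrow> f \<in> arcs E \<Longrightarrow> e \<noteq> f \<Longrightarrow> edge_rel f O (edge_rel e)\<inverse> = {}"
  by (auto simp: edge_rel_def enc_ext_eq_iff)

lemma projection_transport_Id_on: "projection (transport (Id_on A))"
proof -
  have "Id_on A O Id_on A = Id_on A" by auto
  then show ?thesis
    by (simp add: projection_def bounded_operator_transport adjoint_transport
        transport_transport fun_eq_iff)
qed

text \<open>Pairing a projection with \<open>x\<close> gives the squared norm of its value at
  \<open>x\<close>, and the smaller projection factors through the larger one, hence has the smaller
  norm.\<close>

lemma operator_le_transport_Id_on:
  assumes "A \<subseteq> B"
  shows "operator_le (transport (Id_on A)) (transport (Id_on B))"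
  unfolding operator_le_def
proof (intro conjI allI adjoint_eqI)
  let ?P = "transport (Id_on A)" and ?Q = "transport (Id_on B)"
  note P = projectionD[OF projection_transport_Id_on]
  show "(?Q x - ?P x) \<bullet> y = x \<bullet> (?Q y - ?P y)" for x y
    by (simp add: inner_diff_left inner_diff_right P(4))
  fix x
  have sq: "transport (Id_on C) x \<bullet> x = (norm (transport (Id_on C) x))\<^sup>2" for C
    unfolding power2_norm_eq_inner by (metis P(2,4))
  have "Id_on B O Id_on A = Id_on A" using assms by auto
  then have "?P x = ?P (?Q x)" by (simp add: transport_transport)
  then have "norm (?P x) \<le> norm (?Q x)" using P(5) by metis
  then show "0 \<le> (?Q x - ?P x) \<bullet> x"
    by (simp add: inner_diff_left sq power_mono)
qed

lemma projection_vertex_op: "projection (vertex_op v)"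
  unfolding vertex_op_def by (rule projection_transport_Id_on)

lemma bounded_edge_op: "bounded_operator (edge_op e)"
  unfolding edge_op_def by (rule bounded_operator_transport)

text \<open>Every relation reduces to an identity between sets of basis indices. Disjointness of the
  \<open>D v\<close> gives orthogonal vertices and \<open>ext_inject\<close> gives orthogonal edges.
  For a regular vertex, \<open>regular_cover\<close> and \<open>ext_inject\<close> say that the
  images of its edges partition \<open>D v\<close>, so exactly one summand is active at each
  index.\<close>

theorem in_ck_families: "(vertex_op, edge_op) \<in> ck_families E"
proof -
  have orth: "vertex_op v \<circ> vertex_op w = (\<lambda>_. 0)"
    if "v \<in> verts E" "w \<in> verts E" "v \<noteq> w" for v w
  proof -
    have "Id_on (enc ` D w) O Id_on (enc ` D v) = {}"
      using that enc_eq_iff[OF that(2,1)] D_disjoint[OF that(1,2)] by auto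
    then show ?thesis by (simp add: vertex_op_def transport_transport transport_empty fun_eq_iff)
  qed
  have ghost_edge: "adjoint (edge_op e) \<circ> edge_op e = vertex_op (head E e)" if "e \<in> arcs E" for e
    using that by (simp add: adjoint_transport edge_op_def vertex_op_def transport_transport
        partial_inj_edge_rel edge_rel_relcomp fun_eq_iff)
  have range: "edge_op e \<circ> adjoint (edge_op e) = transport (Id_on (enc ` ext e ` D (head E e)))"
    if "e \<in> arcs E" for e
    using that by (simp add: adjoint_transport edge_op_def transport_transport
        partial_inj_edge_rel edge_rel_relcomp fun_eq_iff)
  have iso: "edge_op e \<circ> adjoint (edge_op e) \<circ> edge_op e = edge_op e" if "e \<in> arcs E" for e
  proof -
    have "Id_on (enc ` D (head E e)) O edge_rel e = edge_rel e" by (auto simp: edge_rel_def)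
    then show ?thesis
      unfolding o_assoc[symmetric] ghost_edge[OF that] unfolding edge_op_def vertex_op_def
      using that by (simp add: transport_transport partial_inj_edge_rel fun_eq_iff)
  qed
  have eorth: "adjoint (edge_op e) \<circ> edge_op f = (\<lambda>_. 0)"
    if "e \<in> arcs E" "f \<in> arcs E" "e \<noteq> f" for e f
    using that by (simp add: adjoint_transport edge_op_def transport_transport
        partial_inj_edge_rel edge_rel_orth transport_empty fun_eq_iff)
  have le: "operator_le (edge_op e \<circ> adjoint (edge_op e)) (vertex_op (tail E e))"
    if "e \<in> arcs E" for e
    unfolding range[OF that] vertex_op_def
    using that by (intro operator_le_transport_Id_on) (auto intro: ext_in)
  have reg: "vertex_op v = (\<lambda>x. \<Sum>e\<in>out_arcs E v. edge_op e (adjoint (edge_op e) x))"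
    if v: "regular_vertex E v" for v
  proof (intro ext ell2_eqI)
    fix x n
    let ?B = "\<lambda>e. enc ` ext e ` D (head E e)"
    have fin: "finite (out_arcs E v)" and vv: "v \<in> verts E"
      using v by (auto simp: regular_vertex_def)
    have "ell2_nth (\<Sum>e\<in>out_arcs E v. edge_op e (adjoint (edge_op e) x)) n =
        (\<Sum>e\<in>out_arcs E v. if n \<in> ?B e then ell2_nth x n else 0)"
      unfolding ell2_nth_sum
      using range by (intro sum.cong) (auto simp: fun_eq_iff ell2_nth_transport_Id_on)
    also have "\<dots> = (if n \<in> enc ` D v then ell2_nth x n else 0)"
    proof (cases "n \<in> enc ` D v")
      case True
      then obtain p where p: "p \<in> D v" "n = enc p" by blast
      obtain f q where f: "f \<in> out_arcs E v" "q \<in> D (head E f)" "p = ext f q"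
        using regular_cover[OF v p(1)] by blast
      have "n \<in> ?B e \<longleftrightarrow> e = f" if "e \<in> out_arcs E v" for e
        using that f(1,2) unfolding p(2) f(3) by (auto simp: enc_ext_eq_iff)
      then have "(\<Sum>e\<in>out_arcs E v. if n \<in> ?B e then ell2_nth x n else 0) =
          (\<Sum>e\<in>out_arcs E v. if e = f then ell2_nth x n else 0)"
        by (intro sum.cong) auto
      then show ?thesis using True fin f(1) by simp
    next
      case False
      then have "n \<notin> ?B e" if "e \<in> out_arcs E v" for e
        using that ext_in by fastforce
      then show ?thesis using False by simp
    qed
    finally show "ell2_nth (vertex_op v x) n =
        ell2_nth (\<Sum>e\<in>out_arcs E v. edge_op e (adjoint (edge_op e) x)) n"
      by (simp add: vertex_op_def ell2_nth_transport_Id_on)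
  qed
  show ?thesis
    unfolding ck_families_def mem_Collect_eq prod.case
    unfolding partial_isometry_def
    by (intro conjI ballI allI impI orth iso eorth ghost_edge le reg projection_vertex_op
        bounded_edge_op)
qed

lemma vertex_op_ket:
  assumes "v \<in> verts E" "p \<in> D v" "w \<in> verts E"
  shows "vertex_op w (ket (enc p)) = (if w = v then ket (enc p) else 0)"
proof (cases "w = v")
  case True
  then show ?thesis
    using transport_ket(1)[of "Id_on (enc ` D v)" "enc p" "enc p" 1] assms
    by (simp add: vertex_op_def Id_on_iff)
next
  case False
  then have "enc p \<notin> Domain (Id_on (enc ` D w))"
    using False assms D_disjoint[OF assms(1,3)] enc_eq_iff[OF assms(1,3)] by auto
  then show ?thesis
    using transport_ket(2)[of "Id_on (enc ` D w)" "enc p" 1] False by (simp add: vertex_op_def)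
qed

lemma edge_op_ket:
  assumes "e \<in> arcs E" "p \<in> D (head E e)"
  shows "edge_op e (ket (enc p)) = ket (enc (ext e p))"
  using transport_ket(1)[OF partial_inj_edge_rel[OF assms(1)], of "enc p" "enc (ext e p)" 1] assms
  by (auto simp: edge_op_def edge_rel_def)

lemma adjoint_edge_op_ket:
  assumes "e \<in> arcs E" "v \<in> verts E" "p \<in> D v" "p \<notin> ext e ` D (head E e)"
  shows "adjoint (edge_op e) (ket (enc p)) = 0"
proof -
  have "enc p \<notin> Domain ((edge_rel e)\<inverse>)"
    using assms(4) enc_eq_iff[OF assms(2) tail_in_verts[OF assms(1)] assms(3)] ext_in[OF assms(1)]
    by (auto simp: edge_rel_def)
  then show ?thesis
    using transport_ket(2)[of "(edge_rel e)\<inverse>" "enc p" 1] partial_inj_edge_rel[OF assms(1)]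
    by (simp add: edge_op_def adjoint_transport)
qed

end

section \<open>A faithful branching system\<close>

text \<open>
  Fix an edge out of every regular vertex.  The triple \<open>(v, es, k)\<close> stands for the boundary path
  that starts at \<open>v\<close>, runs through \<open>es\<close>, and then follows the fixed edges, forever or up to a
  vertex that is not regular; \<open>es\<close> is kept free of a fixed edge at its end to make \<open>es\<close> unique.
  The integer \<open>k\<close> records the gauge degree, which separates different paths with the same action
  (for instance along a cycle without exit).
\<close>

definition fixed_edge :: "('v, 'e) pre_digraph \<Rightarrow> 'e \<Rightarrow> bool" where
  "fixed_edge E e \<longleftrightarrow> regular_vertex E (tail E e) \<and> e = (SOME f. f \<in> out_arcs E (tail E e))"

fun reduced_path :: "('v, 'e) pre_digraph \<Rightarrow> 'v \<Rightarrow> 'e list \<Rightarrow> bool" where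
  "reduced_path E v [] \<longleftrightarrow> v \<in> verts E"
| "reduced_path E v (e # es) \<longleftrightarrow> e \<in> arcs E \<and> tail E e = v \<and>
    (es = [] \<longrightarrow> \<not> fixed_edge E e) \<and> reduced_path E (head E e) es"

definition boundary_points :: "('v, 'e) pre_digraph \<Rightarrow> 'v \<Rightarrow> ('v \<times> 'e list \<times> int) set" where
  "boundary_points E v = {(u, es, k). u = v \<and> reduced_path E v es}"

text \<open>Prefixing a fixed edge to a path that only follows fixed edges yields a path of the same
  kind, so its reduced form stays \<open>[]\<close>. If that edge is a loop, the degree is all that
  changes.\<close>

definition boundary_ext ::
  "('v, 'e) pre_digraph \<Rightarrow> 'e \<Rightarrow> 'v \<times> 'e list \<times> int \<Rightarrow> 'v \<times> 'e list \<times> int" where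
  "boundary_ext E e = (\<lambda>(v, es, k).
     (tail E e, if es = [] \<and> fixed_edge E e then [] else e # es, k + 1))"

text \<open>The extra data for injectivity. \<open>base v\<close> gives a basis vector at every
  vertex, and at a vertex that is not regular it is annihilated by all ghost edges.
  \<open>lag\<close> makes the length of a path visible in the points that it produces.\<close>

locale graded_branching_system = branching_system E D ext enc
  for E :: "('v, 'e) pre_digraph" and D :: "'v \<Rightarrow> 'p set" and ext enc +
  fixes base :: "'v \<Rightarrow> 'p" and lag :: "'p \<Rightarrow> int"
  assumes base_in: "v \<in> verts E \<Longrightarrow> base v \<in> D v"
    and base_not_ext: "v \<in> verts E \<Longrightarrow> \<not> regular_vertex E v \<Longrightarrow> e \<in> arcs E \<Longrightarrow>
      base v \<notin> ext e ` D (head E e)"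
    and lag_ext: "lag (ext e p) = lag p + 1"

lemma countable_boundary_points:
  assumes "wf_digraph E" "countable (verts E)" "countable (arcs E)"
  shows "countable (\<Union>v\<in>verts E. boundary_points E v)"
proof (rule countable_subset)
  have "reduced_path E v es \<Longrightarrow> es \<in> lists (arcs E)" for v es
    by (induction es arbitrary: v) auto
  then show "(\<Union>v\<in>verts E. boundary_points E v) \<subseteq> verts E \<times> lists (arcs E) \<times> UNIV"
    by (auto simp: boundary_points_def)
  show "countable (verts E \<times> lists (arcs E) \<times> (UNIV :: int set))"
    using assms by (intro countable_SIGMA countable_lists) auto
qed

lemma boundary_graded_branching_system:
  assumes E: "wf_digraph E" and "countable (verts E)" "countable (arcs E)"
  shows "graded_branching_system E (boundary_points E) (boundary_ext E)
    (to_nat_on (\<Union>v\<in>verts E. boundary_points E v)) (\<lambda>v. (v, [], 0)) (\<lambda>(v, es, k). k)"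
proof -
  interpret wf_digraph E by (rule E)
  have fixed: "(SOME f. f \<in> out_arcs E v) \<in> out_arcs E v" if "regular_vertex E v" for v
    using that someI_ex[of "\<lambda>f. f \<in> out_arcs E v"] unfolding regular_vertex_def by blast
  show ?thesis
  proof unfold_locales
    show "inj_on (to_nat_on (\<Union>v\<in>verts E. boundary_points E v)) (\<Union>v\<in>verts E. boundary_points E v)"
      using countable_boundary_points[OF assms] by (rule inj_on_to_nat_on)
    fix v p assume v: "regular_vertex E v" and "p \<in> boundary_points E v"
    then obtain es k where p: "p = (v, es, k)" "reduced_path E v es"
      by (auto simp: boundary_points_def)
    show "\<exists>e\<in>out_arcs E v. p \<in> boundary_ext E e ` boundary_points E (head E e)"
    proof (cases es)
      case Nil
      \<comment> \<open>The path follows fixed edges from \<open>v\<close> on, so its first edge is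
        the fixed one; removing it lowers the degree by one.\<close>
      define e where "e = (SOME f. f \<in> out_arcs E v)"
      have e: "e \<in> out_arcs E v" unfolding e_def by (rule fixed[OF v])
      then have "p = boundary_ext E e (head E e, [], k - 1)"
        using v Nil p by (auto simp: boundary_ext_def fixed_edge_def e_def)
      moreover have "(head E e, [], k - 1) \<in> boundary_points E (head E e)"
        using e by (auto simp: boundary_points_def)
      ultimately show ?thesis using e by blast
    next
      case (Cons e fs)
      then have "p = boundary_ext E e (head E e, fs, k - 1)"
        using p by (auto simp: boundary_ext_def)
      moreover have "(head E e, fs, k - 1) \<in> boundary_points E (head E e)"
        using p Cons by (auto simp: boundary_points_def)
      moreover have "e \<in> out_arcs E v" using p Cons by auto
      ultimately show ?thesis by blast
    qed
  qed (auto simp: boundary_points_def boundary_ext_def fixed_edge_def split: if_splits)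
qed

section \<open>The free algebra\<close>

text \<open>
  Without vertices and edges only the algebra axioms remain of \<^const>\<open>lpa_cong\<close>, so the quotient
  is the free algebra on the generators.  Being independent of \<open>E\<close>, it is a type.
\<close>

definition empty_graph :: "('v, 'e) pre_digraph" where
  "empty_graph = \<lparr>verts = {}, arcs = {}, tail = undefined, head = undefined\<rparr>"

quotient_type ('v, 'e) free_alg = "('v, 'e) lpa_term" / "lpa_cong (empty_graph :: ('v, 'e) pre_digraph)"
  by (rule equivpI) (auto intro!: reflpI sympI transpI intro: lpa_cong.refl lpa_cong.sym lpa_cong.trans)

instantiation free_alg :: (type, type) ring
begin

lift_definition zero_free_alg :: "('a, 'b) free_alg" is Zero .
lift_definition plus_free_alg :: "('a, 'b) free_alg \<Rightarrow> ('a, 'b) free_alg \<Rightarrow> ('a, 'b) free_alg" is Add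
  by (rule lpa_cong.add_cong)
lift_definition times_free_alg :: "('a, 'b) free_alg \<Rightarrow> ('a, 'b) free_alg \<Rightarrow> ('a, 'b) free_alg" is Mult
  by (rule lpa_cong.mult_cong)
lift_definition uminus_free_alg :: "('a, 'b) free_alg \<Rightarrow> ('a, 'b) free_alg" is "Scale (-1)"
  by (rule lpa_cong.scale_cong)
definition minus_free_alg :: "('a, 'b) free_alg \<Rightarrow> ('a, 'b) free_alg \<Rightarrow> ('a, 'b) free_alg" where
  "minus_free_alg x y = x + - y"

instance
proof
  fix a b c :: "('a, 'b) free_alg"
  show "a + b + c = a + (b + c)" by transfer (rule lpa_cong.add_assoc)
  show "a + b = b + a" by transfer (rule lpa_cong.add_commute)
  show "0 + a = a" by transfer (rule lpa_cong.add_zero)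
  show "- a + a = 0" by transfer (blast intro: lpa_cong.intros)
  show "a - b = a + - b" by (rule minus_free_alg_def)
  show "a * b * c = a * (b * c)" by transfer (rule lpa_cong.mult_assoc)
  show "(a + b) * c = a * c + b * c" by transfer (rule lpa_cong.mult_add_left)
  show "a * (b + c) = a * b + a * c" by transfer (rule lpa_cong.mult_add_right)
qed

end

lift_definition fscale :: "complex \<Rightarrow> ('v, 'e) free_alg \<Rightarrow> ('v, 'e) free_alg" is Scale
  by (rule lpa_cong.scale_cong)
lift_definition vert :: "'v \<Rightarrow> ('v, 'e) free_alg" is Vertex .
lift_definition edge :: "'e \<Rightarrow> ('v, 'e) free_alg" is Edge .
lift_definition ghost :: "'e \<Rightarrow> ('v, 'e) free_alg" is Ghost .

lemma fscale_simps:
  "fscale 1 x = x" "fscale k (fscale l x) = fscale (k * l) x"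
  "fscale k (x + y) = fscale k x + fscale k y" "fscale (k + l) x = fscale k x + fscale l x"
  "fscale k x * y = fscale k (x * y)" "x * fscale k y = fscale k (x * y)"
  "fscale (- 1) x = - x"
  by (transfer, blast intro: lpa_cong.intros)+

lemma fscale_0 [simp]: "fscale 0 x = 0" "fscale k 0 = 0"
  using fscale_simps(4)[of 0 0 x] fscale_simps(3)[of k 0 0] by simp_all

lemma fscale_sum: "fscale k (\<Sum>i\<in>A. f i) = (\<Sum>i\<in>A. fscale k (f i))"
  by (induction A rule: infinite_finite_induct) (simp_all add: fscale_simps)

section \<open>The graph relations as a congruence on the free algebra\<close>

lemma lpa_cong_empty_graph: "lpa_cong empty_graph a b \<Longrightarrow> lpa_cong E a b"
  by (induction rule: lpa_cong.induct)
    (auto simp: empty_graph_def regular_vertex_def intro: lpa_cong.intros)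

text \<open>Separates the two layers of \<open>lpa_cong\<close>: the algebra axioms become equations
  in a ring, open to simplification and finite sums, and only the graph relations remain in the
  congruence.\<close>

lift_definition fcong :: "('v, 'e) pre_digraph \<Rightarrow> ('v, 'e) free_alg \<Rightarrow> ('v, 'e) free_alg \<Rightarrow> bool"
  is lpa_cong
  by (meson lpa_cong.sym lpa_cong.trans lpa_cong_empty_graph)

lemma fcong_abs_iff: "fcong E (abs_free_alg a) (abs_free_alg b) \<longleftrightarrow> lpa_cong E a b"
  by (simp add: fcong.abs_eq)

lemma abs_free_alg_simps:
  "abs_free_alg (Vertex v) = vert v" "abs_free_alg (Edge e) = edge e"
  "abs_free_alg (Ghost e) = ghost e" "abs_free_alg Zero = 0"
  "abs_free_alg (Add a b) = abs_free_alg a + abs_free_alg b"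
  "abs_free_alg (Scale k a) = fscale k (abs_free_alg a)"
  "abs_free_alg (Mult a b) = abs_free_alg a * abs_free_alg b"
  by (simp_all add: vert.abs_eq edge.abs_eq ghost.abs_eq zero_free_alg.abs_eq plus_free_alg.abs_eq
      fscale.abs_eq times_free_alg.abs_eq vert_def edge_def ghost_def zero_free_alg_def)

lemma fcong_refl [simp]: "fcong E x x"
  by transfer (rule lpa_cong.refl)

lemma fcong_sym: "fcong E x y \<Longrightarrow> fcong E y x"
  by transfer (rule lpa_cong.sym)

lemma fcong_trans [trans]: "fcong E x y \<Longrightarrow> fcong E y z \<Longrightarrow> fcong E x z"
  by transfer (rule lpa_cong.trans)

lemma fcong_add: "fcong E x x' \<Longrightarrow> fcong E y y' \<Longrightarrow> fcong E (x + y) (x' + y')"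
  by transfer (rule lpa_cong.add_cong)

lemma fcong_mult: "fcong E x x' \<Longrightarrow> fcong E y y' \<Longrightarrow> fcong E (x * y) (x' * y')"
  by transfer (rule lpa_cong.mult_cong)

lemma fcong_scale: "fcong E x x' \<Longrightarrow> fcong E (fscale k x) (fscale k x')"
  by transfer (rule lpa_cong.scale_cong)

lemma fcong_mult_left: "fcong E x x' \<Longrightarrow> fcong E (x * y) (x' * y)"
  by (simp add: fcong_mult)

lemma fcong_mult_right: "fcong E y y' \<Longrightarrow> fcong E (x * y) (x * y')"
  by (simp add: fcong_mult)

lemma fcong_sum: "(\<And>i. i \<in> A \<Longrightarrow> fcong E (f i) (g i)) \<Longrightarrow> fcong E (\<Sum>i\<in>A. f i) (\<Sum>i\<in>A. g i)"
  by (induction A rule: infinite_finite_induct) (auto intro: fcong_add)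

lemma fcong_sum_0: "(\<And>i. i \<in> A \<Longrightarrow> fcong E (f i) 0) \<Longrightarrow> fcong E (\<Sum>i\<in>A. f i) 0"
  using fcong_sum[of A E f "\<lambda>_. 0"] by simp

lemma fcong_relations:
  "v \<in> verts E \<Longrightarrow> fcong E (vert v * vert v) (vert v)"
  "v \<in> verts E \<Longrightarrow> w \<in> verts E \<Longrightarrow> v \<noteq> w \<Longrightarrow> fcong E (vert v * vert w) 0"
  "e \<in> arcs E \<Longrightarrow> fcong E (vert (tail E e) * edge e) (edge e)"
  "e \<in> arcs E \<Longrightarrow> fcong E (edge e * vert (head E e)) (edge e)"
  "e \<in> arcs E \<Longrightarrow> fcong E (vert (head E e) * ghost e) (ghost e)"
  "e \<in> arcs E \<Longrightarrow> fcong E (ghost e * vert (tail E e)) (ghost e)"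
  "e \<in> arcs E \<Longrightarrow> fcong E (ghost e * edge e) (vert (head E e))"
  "e \<in> arcs E \<Longrightarrow> f \<in> arcs E \<Longrightarrow> e \<noteq> f \<Longrightarrow> fcong E (ghost e * edge f) 0"
  by (transfer, blast intro: lpa_cong.intros)+

lemma abs_free_alg_foldr:
  "distinct es \<Longrightarrow> abs_free_alg (foldr (\<lambda>e. Add (Mult (Edge e) (Ghost e))) es Zero) =
    (\<Sum>e\<in>set es. edge e * ghost e)"
  by (induction es) (auto simp: abs_free_alg_simps)

lemma fcong_regular:
  assumes "regular_vertex E v"
  shows "fcong E (vert v) (\<Sum>e\<in>out_arcs E v. edge e * ghost e)"
proof -
  obtain es where es: "distinct es" "set es = out_arcs E v"
    using assms finite_distinct_list by (metis regular_vertex_def)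
  show ?thesis
    using lpa_cong.regular[OF assms es]
    by (simp add: fcong_abs_iff[symmetric] abs_free_alg_simps(1) abs_free_alg_foldr es)
qed

section \<open>The span of the monomials\<close>

text \<open>Paths are given by their source and the list of their edges in reverse order.\<close>

fun path_range :: "('v, 'e) pre_digraph \<Rightarrow> 'v \<Rightarrow> 'e list \<Rightarrow> 'v" where
  "path_range E u [] = u"
| "path_range E u (e # es) = head E e"

fun rev_path :: "('v, 'e) pre_digraph \<Rightarrow> 'v \<Rightarrow> 'e list \<Rightarrow> bool" where
  "rev_path E u [] \<longleftrightarrow> u \<in> verts E"
| "rev_path E u (e # es) \<longleftrightarrow> e \<in> arcs E \<and> tail E e = path_range E u es \<and> rev_path E u es"

lemma rev_path_start: "rev_path E u es \<Longrightarrow> u \<in> verts E"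
  by (induction es) auto

text \<open>In the reversed order \<open>Cons\<close> appends the last edge of a path, just as right
  multiplication by an edge does.\<close>

fun path_elem :: "'v \<Rightarrow> 'e list \<Rightarrow> ('v, 'e) free_alg" where
  "path_elem u [] = vert u"
| "path_elem u (e # es) = path_elem u es * edge e"

text \<open>
  Up to the relations of the algebra, the elements of \<open>mono_span E N\<close> are the combinations of
  monomials \<open>\<alpha> \<beta>\<^sup>*\<close> in which the path \<open>\<beta>\<close> has length at most \<open>N\<close>.
\<close>

inductive mono_span :: "('v, 'e) pre_digraph \<Rightarrow> nat \<Rightarrow> ('v, 'e) free_alg \<Rightarrow> bool"
  for E :: "('v, 'e) pre_digraph" where
  path: "rev_path E u es \<Longrightarrow> mono_span E N (path_elem u es)"
| ghost: "mono_span E N x \<Longrightarrow> e \<in> arcs E \<Longrightarrow> mono_span E (Suc N) (x * ghost e)"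
| zero: "mono_span E N 0"
| add: "mono_span E N x \<Longrightarrow> mono_span E N y \<Longrightarrow> mono_span E N (x + y)"
| scale: "mono_span E N x \<Longrightarrow> mono_span E N (fscale k x)"

lemma mono_span_Suc: "mono_span E N x \<Longrightarrow> mono_span E (Suc N) x"
  by (induction rule: mono_span.induct) (auto intro: mono_span.intros)

lemma mono_span_mono: "mono_span E N x \<Longrightarrow> N \<le> M \<Longrightarrow> mono_span E M x"
  by (rule dec_induct) (auto intro: mono_span_Suc)

text \<open>\<open>A\<close> is a set, so every path occurs once with its collected coefficient;
  this is what allows a single basis vector to isolate a coefficient later.\<close>

lemma mono_span_0_expand:
  assumes "mono_span E N x" "N = 0"
  shows "\<exists>A c. finite A \<and> (\<forall>(u, es)\<in>A. rev_path E u es) \<and>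
    x = (\<Sum>a\<in>A. fscale (c a) (path_elem (fst a) (snd a)))"
  using assms
proof induction
  case (path u es N)
  then show ?case
    by (intro exI[of _ "{(u, es)}"] exI[of _ "\<lambda>_. 1"]) (simp add: fscale_simps)
next
  case (zero N)
  then show ?case by (intro exI[of _ "{}"]) simp
next
  case (add N x y)
  obtain A c where A: "finite A" "\<forall>(u, es)\<in>A. rev_path E u es"
      "x = (\<Sum>a\<in>A. fscale (c a) (path_elem (fst a) (snd a)))"
    using add.IH(1)[OF add.prems] by blast
  obtain B d where B: "finite B" "\<forall>(u, es)\<in>B. rev_path E u es"
      "y = (\<Sum>a\<in>B. fscale (d a) (path_elem (fst a) (snd a)))"
    using add.IH(2)[OF add.prems] by blast
  \<comment> \<open>Both coefficient functions are extended by zero to the union of the index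
    sets.\<close>
  define c' where "c' a = (if a \<in> A then c a else 0)" for a
  define d' where "d' a = (if a \<in> B then d a else 0)" for a
  have "x = (\<Sum>a\<in>A \<union> B. fscale (c' a) (path_elem (fst a) (snd a)))"
    unfolding A(3) by (rule sum.mono_neutral_cong_left) (auto simp: A(1) B(1) c'_def)
  moreover have "y = (\<Sum>a\<in>A \<union> B. fscale (d' a) (path_elem (fst a) (snd a)))"
    unfolding B(3) by (rule sum.mono_neutral_cong_left) (auto simp: A(1) B(1) d'_def)
  ultimately have "x + y = (\<Sum>a\<in>A \<union> B. fscale (c' a + d' a) (path_elem (fst a) (snd a)))"
    by (simp add: sum.distrib fscale_simps)
  moreover have "finite (A \<union> B)" "\<forall>(u, es)\<in>A \<union> B. rev_path E u es"
    using A(1,2) B(1,2) by auto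
  ultimately show ?case
    by (intro exI[of _ "A \<union> B"] exI[of _ "\<lambda>a. c' a + d' a"] conjI)
next
  case (scale N x k)
  obtain A c where A: "finite A" "\<forall>(u, es)\<in>A. rev_path E u es"
      "x = (\<Sum>a\<in>A. fscale (c a) (path_elem (fst a) (snd a)))"
    using scale.IH[OF scale.prems] by blast
  then show ?case
    by (intro exI[of _ A] exI[of _ "\<lambda>a. k * c a"]) (simp add: fscale_sum fscale_simps)
qed simp

text \<open>Groups a combination by its rightmost ghost edge, with the summands free of ghost edges
  in \<open>p\<close>. Right multiplication by an edge then picks out a single
  \<open>y e\<close>.\<close>

lemma mono_span_Suc_expand:
  assumes "mono_span E M x" "M = Suc N"
  shows "\<exists>p A y. mono_span E 0 p \<and> finite A \<and> A \<subseteq> arcs E \<and> (\<forall>e. mono_span E N (y e)) \<and>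
    x = p + (\<Sum>e\<in>A. y e * ghost e)"
  using assms
proof induction
  case (path u es M)
  then show ?case
    by (intro exI[of _ "path_elem u es"] exI[of _ "{}"] exI[of _ "\<lambda>_. 0"])
      (auto intro: mono_span.intros)
next
  case (ghost M x e)
  then show ?case
    by (intro exI[of _ 0] exI[of _ "{e}"] exI[of _ "\<lambda>_. x"]) (auto intro: mono_span.intros)
next
  case (zero M)
  then show ?case
    by (intro exI[of _ 0] exI[of _ "{}"] exI[of _ "\<lambda>_. 0"]) (auto intro: mono_span.intros)
next
  case (add M x x')
  obtain p A y where
    *: "mono_span E 0 p" "finite A" "A \<subseteq> arcs E" "\<forall>e. mono_span E N (y e)"
      "x = p + (\<Sum>e\<in>A. y e * ghost e)"
    using add.IH(1)[OF add.prems] by blast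
  obtain p' A' y' where
    **: "mono_span E 0 p'" "finite A'" "A' \<subseteq> arcs E" "\<forall>e. mono_span E N (y' e)"
      "x' = p' + (\<Sum>e\<in>A'. y' e * ghost e)"
    using add.IH(2)[OF add.prems] by blast
  define z where "z e = (if e \<in> A then y e else 0)" for e
  define z' where "z' e = (if e \<in> A' then y' e else 0)" for e
  have "(\<Sum>e\<in>A. y e * ghost e) = (\<Sum>e\<in>A \<union> A'. z e * ghost e)"
    by (rule sum.mono_neutral_cong_left) (auto simp: *(2) **(2) z_def)
  moreover have "(\<Sum>e\<in>A'. y' e * ghost e) = (\<Sum>e\<in>A \<union> A'. z' e * ghost e)"
    by (rule sum.mono_neutral_cong_left) (auto simp: *(2) **(2) z'_def)
  ultimately have "x + x' = (p + p') + (\<Sum>e\<in>A \<union> A'. (z e + z' e) * ghost e)"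
    by (simp add: *(5) **(5) sum.distrib distrib_right)
  moreover have "mono_span E N (z e + z' e)" for e
    using *(4) **(4) by (auto simp: z_def z'_def intro: mono_span.intros)
  moreover have "finite (A \<union> A')" "A \<union> A' \<subseteq> arcs E" using * ** by auto
  moreover have "mono_span E 0 (p + p')" using * ** by (auto intro: mono_span.intros)
  ultimately show ?case
    by (intro exI[of _ "p + p'"] exI[of _ "A \<union> A'"] exI[of _ "\<lambda>e. z e + z' e"] conjI allI)
next
  case (scale M x k)
  obtain p A y where
    *: "mono_span E 0 p" "finite A" "A \<subseteq> arcs E" "\<forall>e. mono_span E N (y e)"
      "x = p + (\<Sum>e\<in>A. y e * ghost e)"
    using scale.IH[OF scale.prems] by blast
  then show ?case
    by (intro exI[of _ "fscale k p"] exI[of _ A] exI[of _ "\<lambda>e. fscale k (y e)"])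
      (auto simp: fscale_simps fscale_sum intro: mono_span.intros)
qed

section \<open>Right multiplication of monomials by generators\<close>

context wf_digraph
begin

lemma path_range_in_verts: "rev_path G u es \<Longrightarrow> path_range G u es \<in> verts G"
  by (cases es) auto

lemma path_elem_range:
  assumes "rev_path G u es"
  shows "fcong G (path_elem u es * vert (path_range G u es)) (path_elem u es)"
  using assms by (cases es) (auto simp: mult.assoc intro: fcong_relations fcong_mult_right)

lemma fcong_mult_vert_vert_0:
  assumes "fcong G (x * vert v) x" "v \<in> verts G" "w \<in> verts G" "v \<noteq> w"
  shows "fcong G (x * vert w) 0"
proof -
  have "fcong G (x * vert w) (x * vert v * vert w)"
    by (intro fcong_mult_left fcong_sym[OF assms(1)])
  also have "fcong G (x * vert v * vert w) (x * 0)"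
    unfolding mult.assoc using assms by (intro fcong_mult_right fcong_relations)
  finally show ?thesis by simp
qed

lemma ghost_tail: "e \<in> arcs G \<Longrightarrow> fcong G (x * ghost e * vert (tail G e)) (x * ghost e)"
  unfolding mult.assoc by (intro fcong_mult_right fcong_relations)

lemma mono_span_mult_vert:
  assumes "mono_span G N x" and v: "v \<in> verts G"
  shows "\<exists>y. mono_span G N y \<and> fcong G (x * vert v) y"
  using assms(1)
proof induction
  case (path u es N)
  note r = path_elem_range[OF path] path_range_in_verts[OF path]
  show ?case
  proof (cases "v = path_range G u es")
    case True
    then show ?thesis
      using r(1) by (intro exI[of _ "path_elem u es"] conjI mono_span.path[OF path]) simp
  next
    case False
    then show ?thesis using fcong_mult_vert_vert_0[OF r v] mono_span.zero by metis
  qed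
next
  case (ghost N x e)
  show ?case
  proof (cases "v = tail G e")
    case True
    then show ?thesis using ghost ghost_tail mono_span.ghost by metis
  next
    case False
    then show ?thesis
      using fcong_mult_vert_vert_0[OF ghost_tail] ghost(2) v mono_span.zero tail_in_verts by metis
  qed
next
  case (zero N)
  then show ?case by (intro exI[of _ 0]) (simp add: mono_span.zero)
next
  case (add N x y)
  then show ?case by (metis distrib_right fcong_add mono_span.add)
next
  case (scale N x k)
  then show ?case by (metis fscale_simps(5) fcong_scale mono_span.scale)
qed

text \<open>A monomial ending in a ghost edge loses it or vanishes. A monomial without ghost edges
  vanishes or grows only on the path side, which \<open>N\<close> does not count. Either way the
  bound drops by one.\<close>

lemma mono_span_Suc_mult_edge:
  assumes "mono_span G M x" "M = Suc N" and e: "e \<in> arcs G"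
  shows "\<exists>y. mono_span G N y \<and> fcong G (x * edge e) y"
  using assms(1,2)
proof induction
  case (path u es N')
  note r = path_elem_range[OF path(1)] path_range_in_verts[OF path(1)]
  show ?case
  proof (cases "tail G e = path_range G u es")
    case True
    then have "rev_path G u (e # es)" using path e by simp
    then show ?thesis using mono_span.path[of G u "e # es" N] fcong_refl by fastforce
  next
    case False
    have "fcong G (path_elem u es * edge e) (path_elem u es * vert (tail G e) * edge e)"
      unfolding mult.assoc by (intro fcong_mult_right fcong_sym[OF fcong_relations(3)] e)
    also have "fcong G \<dots> (0 * edge e)"
      using r False e by (intro fcong_mult_left fcong_mult_vert_vert_0) auto
    finally show ?thesis using mono_span.zero by (metis mult_zero_left)
  qed
next
  case (ghost N' x f)
  show ?case
  proof (cases "f = e")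
    case True
    then have "fcong G (x * ghost f * edge e) (x * vert (head G e))"
      unfolding mult.assoc using e by (intro fcong_mult_right) (simp add: fcong_relations)
    then show ?thesis
      using mono_span_mult_vert[OF ghost(1)] ghost(4) e fcong_trans head_in_verts
      by (metis nat.inject)
  next
    case False
    then have "fcong G (x * ghost f * edge e) (x * 0)"
      unfolding mult.assoc using e ghost(2) by (intro fcong_mult_right fcong_relations)
    then show ?thesis using mono_span.zero by (metis mult_zero_right)
  qed
next
  case (zero N')
  then show ?case by (intro exI[of _ 0]) (simp add: mono_span.zero)
next
  case (add N' x y)
  then show ?case by (metis distrib_right fcong_add mono_span.add)
next
  case (scale N' x k)
  then show ?case by (metis fscale_simps(5) fcong_scale mono_span.scale)
qed

text \<open>With \<open>N\<close> and \<open>x\<close> arbitrary in the induction, the factors of a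
  product are multiplied onto \<open>x\<close> one after the other, so no general product of two
  monomials has to be computed.\<close>

lemma mono_span_mult_term:
  assumes "t \<in> lpa_terms G" "mono_span G N x"
  shows "\<exists>M y. mono_span G M y \<and> fcong G (x * abs_free_alg t) y"
  using assms
proof (induction arbitrary: N x)
  case (1 v)
  then show ?case using mono_span_mult_vert by (metis abs_free_alg_simps(1))
next
  case (2 e)
  then show ?case
    using mono_span_Suc_mult_edge[OF mono_span_Suc HOL.refl] by (metis abs_free_alg_simps(2))
next
  case (3 e)
  then show ?case using mono_span.ghost fcong_refl by (metis abs_free_alg_simps(3))
next
  case 4
  then show ?case using mono_span.zero fcong_refl by (metis abs_free_alg_simps(4) mult_zero_right)
next
  case (5 a b)
  then obtain M y M' y' where "mono_span G M y" "fcong G (x * abs_free_alg a) y"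
    "mono_span G M' y'" "fcong G (x * abs_free_alg b) y'" by metis
  then have "mono_span G (max M M') (y + y')" "fcong G (x * abs_free_alg (Add a b)) (y + y')"
    by (auto simp: abs_free_alg_simps distrib_left intro: fcong_add mono_span.add
        mono_span_mono[OF _ max.cobounded1] mono_span_mono[OF _ max.cobounded2])
  then show ?case by blast
next
  case (6 a c)
  then show ?case by (metis abs_free_alg_simps(6) fscale_simps(6) fcong_scale mono_span.scale)
next
  case (7 a b)
  then obtain M y where y: "mono_span G M y" "fcong G (x * abs_free_alg a) y" by metis
  obtain M' z where z: "mono_span G M' z" "fcong G (y * abs_free_alg b) z"
    using 7 y(1) by metis
  have "fcong G (x * abs_free_alg (Mult a b)) (y * abs_free_alg b)"
    by (simp add: abs_free_alg_simps mult.assoc[symmetric] fcong_mult_left y(2))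
  then show ?case using z fcong_trans by blast
qed

lemma term_in_mono_span:
  assumes "t \<in> lpa_terms G"
  shows "\<exists>N x. mono_span G N x \<and> fcong G (abs_free_alg t) x"
  using assms
proof induction
  case (1 v)
  then have "mono_span G 0 (vert v)" using mono_span.path[of G v "[]"] by simp
  then show ?case using fcong_refl by (metis abs_free_alg_simps(1))
next
  case (2 e)
  then have "mono_span G 0 (vert (tail G e) * edge e)"
    using mono_span.path[of G "tail G e" "[e]"] by simp
  then show ?case using fcong_sym[OF fcong_relations(3)[OF 2]] by (metis abs_free_alg_simps(2))
next
  case (3 e)
  then have "mono_span G (Suc 0) (vert (head G e) * ghost e)"
    using mono_span.ghost[OF mono_span.path[of G "head G e" "[]"]] by simp
  then show ?case using fcong_sym[OF fcong_relations(5)[OF 3]] by (metis abs_free_alg_simps(3))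
next
  case 4
  then show ?case using mono_span.zero fcong_refl by (metis abs_free_alg_simps(4))
next
  case (5 a b)
  then obtain M y M' y' where "mono_span G M y" "fcong G (abs_free_alg a) y"
    "mono_span G M' y'" "fcong G (abs_free_alg b) y'" by metis
  then have "mono_span G (max M M') (y + y')" "fcong G (abs_free_alg (Add a b)) (y + y')"
    by (auto simp: abs_free_alg_simps intro: fcong_add mono_span.add
        mono_span_mono[OF _ max.cobounded1] mono_span_mono[OF _ max.cobounded2])
  then show ?case by blast
next
  case (6 a c)
  then show ?case by (metis abs_free_alg_simps(6) fcong_scale mono_span.scale)
next
  case (7 a b)
  then obtain M y where y: "mono_span G M y" "fcong G (abs_free_alg a) y" by metis
  obtain M' z where z: "mono_span G M' z" "fcong G (y * abs_free_alg b) z"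
    using mono_span_mult_term[OF 7(2) y(1)] by metis
  have "fcong G (abs_free_alg (Mult a b)) (y * abs_free_alg b)"
    by (simp add: abs_free_alg_simps fcong_mult_left y(2))
  then show ?case using z fcong_trans by blast
qed

section \<open>Local units\<close>

lemma fcong_local_unit:
  assumes x: "fcong G (x * vert w) x" and w: "w \<in> U" and U: "finite U" "U \<subseteq> verts G"
  shows "fcong G (x * (\<Sum>v\<in>U. vert v)) x"
proof -
  have "fcong G (\<Sum>v\<in>U. x * vert v) (\<Sum>v\<in>U. if v = w then x else 0)"
    using assms by (intro fcong_sum) (auto intro: fcong_mult_vert_vert_0)
  then show ?thesis using w U by (simp add: sum_distrib_left)
qed

lemma mono_span_local_unit:
  assumes "mono_span G N x"
  shows "\<exists>V. finite V \<and> V \<subseteq> verts G \<and>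
    (\<forall>U. finite U \<longrightarrow> V \<subseteq> U \<longrightarrow> U \<subseteq> verts G \<longrightarrow> fcong G (x * (\<Sum>v\<in>U. vert v)) x)"
  using assms
proof induction
  case (path u es N)
  then show ?case using fcong_local_unit[OF path_elem_range[OF path]] path_range_in_verts[OF path]
    by (intro exI[of _ "{path_range G u es}"]) auto
next
  case (ghost N x e)
  then show ?case using fcong_local_unit[OF ghost_tail[OF ghost(2)]]
    by (intro exI[of _ "{tail G e}"]) auto
next
  case (zero N)
  then show ?case by (intro exI[of _ "{}"]) simp
next
  case (add N x y)
  obtain V where V: "finite V" "V \<subseteq> verts G"
    "\<forall>U. finite U \<longrightarrow> V \<subseteq> U \<longrightarrow> U \<subseteq> verts G \<longrightarrow> fcong G (x * (\<Sum>v\<in>U. vert v)) x"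
    using add.IH(1) by (elim exE conjE)
  obtain W where W: "finite W" "W \<subseteq> verts G"
    "\<forall>U. finite U \<longrightarrow> W \<subseteq> U \<longrightarrow> U \<subseteq> verts G \<longrightarrow> fcong G (y * (\<Sum>v\<in>U. vert v)) y"
    using add.IH(2) by (elim exE conjE)
  show ?case
    unfolding distrib_right
    by (intro exI[of _ "V \<union> W"] conjI allI impI fcong_add V(3)[rule_format] W(3)[rule_format])
      (use V(1,2) W(1,2) in auto)
next
  case (scale N x k)
  then show ?case by (metis fscale_simps(5) fcong_scale)
qed

text \<open>The algebra need not have a unit, but a finite sum of vertices acts as a right unit on
  \<open>x\<close>; hence vanishing can be tested vertex by vertex.\<close>

lemma fcong_0I:
  assumes "mono_span G N x" and 0: "\<And>v. v \<in> verts G \<Longrightarrow> fcong G (x * vert v) 0"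
  shows "fcong G x 0"
proof -
  obtain V where V: "finite V" "V \<subseteq> verts G"
    "\<forall>U. finite U \<longrightarrow> V \<subseteq> U \<longrightarrow> U \<subseteq> verts G \<longrightarrow> fcong G (x * (\<Sum>v\<in>U. vert v)) x"
    using mono_span_local_unit[OF assms(1)] by (elim exE conjE)
  have "fcong G x (x * (\<Sum>v\<in>V. vert v))"
    by (rule fcong_sym) (rule V(3)[rule_format, OF V(1) subset_refl V(2)])
  also have "fcong G \<dots> 0"
    unfolding sum_distrib_left using V(2) by (intro fcong_sum_0 0) auto
  finally show ?thesis .
qed

end

section \<open>Injectivity of the canonical map\<close>

context graded_branching_system
begin

section \<open>Evaluation of the free algebra on boundary points\<close>

definition branching_family :: "('v, 'e) operator_family" where
  "branching_family = zero_extend E (vertex_op, edge_op)"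

text \<open>The representative is chosen arbitrarily and may mention vertices and edges outside the
  graph; the extension by zero in \<open>branching_family\<close> makes the value independent of
  it.\<close>

definition eval_op :: "('v, 'e) free_alg \<Rightarrow> ell2 \<Rightarrow> ell2" where
  "eval_op x = term_operator branching_family (rep_free_alg x)"

lemma lpa_cong_imp_branching_eq:
  "lpa_cong E a b \<Longrightarrow> term_operator branching_family a = term_operator branching_family b"
  unfolding branching_family_def
  by (rule lpa_cong_imp_zero_extend_eq[OF wf_digraph_axioms in_ck_families])

lemma eval_op_cong: "fcong E x y \<Longrightarrow> eval_op x = eval_op y"
  unfolding eval_op_def fcong.rep_eq by (rule lpa_cong_imp_branching_eq)

lemma eval_op_abs: "eval_op (abs_free_alg t) = term_operator branching_family t"
  unfolding eval_op_def
  by (rule lpa_cong_imp_branching_eq, rule lpa_cong_empty_graph,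
      rule Quotient_rep_abs[OF Quotient_free_alg], rule lpa_cong.refl)

lemma ex_abs_free_alg: "\<exists>t. x = abs_free_alg t"
  by (metis Quotient_abs_rep[OF Quotient_free_alg])

lemma bounded_eval_op: "bounded_operator (eval_op x)"
  unfolding eval_op_def branching_family_def
  by (rule bounded_operator_term) (rule bounded_operator_zero_extend[OF in_ck_families])+

lemma eval_op_simps:
  "eval_op (x + y) p = eval_op x p + eval_op y p" "eval_op (x * y) p = eval_op x (eval_op y p)"
  "eval_op (fscale k x) p = cscale k (eval_op x p)" "eval_op 0 p = 0"
proof -
  obtain a b where "x = abs_free_alg a" "y = abs_free_alg b" using ex_abs_free_alg by metis
  then show "eval_op (x + y) p = eval_op x p + eval_op y p"
    "eval_op (x * y) p = eval_op x (eval_op y p)" "eval_op (fscale k x) p = cscale k (eval_op x p)"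
    by (simp_all add: abs_free_alg_simps(5-7)[symmetric] eval_op_abs)
  show "eval_op 0 p = 0" by (simp add: abs_free_alg_simps(4)[symmetric] eval_op_abs)
qed

lemma eval_op_sum: "eval_op (\<Sum>i\<in>A. f i) p = (\<Sum>i\<in>A. eval_op (f i) p)"
  by (induction A rule: infinite_finite_induct) (simp_all add: eval_op_simps)

lemma eval_op_generators:
  "v \<in> verts E \<Longrightarrow> eval_op (vert v) = vertex_op v"
  "e \<in> arcs E \<Longrightarrow> eval_op (edge e) = edge_op e"
  "e \<in> arcs E \<Longrightarrow> eval_op (ghost e) = adjoint (edge_op e)"
  by (simp_all add: abs_free_alg_simps(1-3)[symmetric] eval_op_abs branching_family_def
      zero_extend_def)

text \<open>The list is reversed, so the last edge of the path is the first to be prefixed to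
  \<open>q\<close>.\<close>

fun act :: "'e list \<Rightarrow> 'p \<Rightarrow> 'p" where
  "act [] q = q"
| "act (e # es) q = act es (ext e q)"

lemma act_in: "rev_path E u es \<Longrightarrow> q \<in> D (path_range E u es) \<Longrightarrow> act es q \<in> D u"
proof (induction es arbitrary: q)
  case (Cons e es)
  then show ?case using ext_in[of e q] by auto
qed simp

lemma lag_act: "lag (act es q) = lag q + int (length es)"
  by (induction es arbitrary: q) (simp_all add: lag_ext)

text \<open>Equal lengths allow induction on both paths at once, with injectivity of
  \<open>ext\<close> removing one edge from each; \<open>lag\<close> supplies this premise in
  \<open>act_eq_iff\<close>.\<close>

lemma act_inject:
  assumes "rev_path E u es" "rev_path E u' es'" "q \<in> D (path_range E u es)"
    "q' \<in> D (path_range E u' es')" "length es = length es'" "act es q = act es' q'"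
  shows "u = u' \<and> es = es' \<and> q = q'"
  using assms(5,1-4,6)
proof (induction es es' arbitrary: q q' rule: list_induct2)
  case Nil
  then show ?case using D_disjoint by auto
next
  case (Cons e es e' es')
  then have "u = u' \<and> es = es' \<and> ext e q = ext e' q'"
    using Cons.IH[of "ext e q" "ext e' q'"] ext_in[of e q] ext_in[of e' q'] by auto
  then show ?case using Cons.prems ext_inject[of e e' q q'] by auto
qed

lemma act_eq_iff:
  assumes "rev_path E u es" "rev_path E u' es'" "q \<in> D (path_range E u es)"
    "q \<in> D (path_range E u' es')"
  shows "act es q = act es' q \<longleftrightarrow> u = u' \<and> es = es'"
proof
  assume eq: "act es q = act es' q"
  then have "length es = length es'" using lag_act[of es q] lag_act[of es' q] by simp
  then show "u = u' \<and> es = es'" using act_inject[OF assms] eq by blast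
next
  assume "u = u' \<and> es = es'" then show "act es q = act es' q" by simp
qed

lemma eval_op_path:
  assumes "rev_path E u es" "v \<in> verts E" "q \<in> D v"
  shows "eval_op (path_elem u es) (ket (enc q)) =
    (if v = path_range E u es then ket (enc (act es q)) else 0)"
  using assms
proof (induction es arbitrary: v q)
  case Nil
  then show ?case by (auto simp: eval_op_generators vertex_op_ket)
next
  case (Cons e es)
  then have e: "e \<in> arcs E" and es: "rev_path E u es" and te: "tail E e = path_range E u es"
    by auto
  have 1: "eval_op (path_elem u (e # es)) (ket (enc q)) =
      eval_op (path_elem u es) (edge_op e (ket (enc q)))"
    by (simp add: eval_op_simps eval_op_generators e)
  show ?case
  proof (cases "v = head E e")
    case True
    then show ?thesis
      using Cons.IH[OF es path_range_in_verts[OF es], of "ext e q"] Cons.prems ext_in[of e q] e te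
      by (simp add: 1 edge_op_ket del: path_elem.simps)
  next
    case False
    \<comment> \<open>An edge operator factors through the vertex projection at its head, which
      kills the basis vectors of all other vertices.\<close>
    have "edge_op e (ket (enc q)) = edge_op e (vertex_op (head E e) (ket (enc q)))"
      using ck_edge_head[OF wf_digraph_axioms in_ck_families e] by simp
    also have "\<dots> = 0"
      using False e Cons.prems
      by (simp add: vertex_op_ket[of v] bounded_operatorD(4)[OF bounded_edge_op])
    finally show ?thesis
      using False by (simp add: 1 bounded_operatorD(4)[OF bounded_eval_op] del: path_elem.simps)
  qed
qed

text \<open>
  Distinct paths move the basis vector of a point to distinct basis vectors, because the degrees
  of the images tell the lengths of the paths.
\<close>

lemma path_span_eval_0:
  assumes p: "mono_span E 0 p" and v: "v \<in> verts E" and q: "q \<in> D v"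
    and 0: "eval_op p (ket (enc q)) = 0"
  shows "fcong E (p * vert v) 0"
proof -
  obtain A c where A: "finite A" "\<forall>(u, es)\<in>A. rev_path E u es"
    and pA: "p = (\<Sum>a\<in>A. fscale (c a) (path_elem (fst a) (snd a)))"
    using mono_span_0_expand[OF p HOL.refl] by (elim exE conjE)
  have path: "rev_path E (fst a) (snd a)" if "a \<in> A" for a using A(2) that by auto
  have c0: "c b = 0" if b: "b \<in> A" and bv: "path_range E (fst b) (snd b) = v" for b
  proof -
    \<comment> \<open>Among the paths in \<open>A\<close> only \<open>b\<close> moves
      \<open>q\<close> to \<open>act (snd b) q\<close>, so this coordinate isolates
      \<open>c b\<close>.\<close>
    have coord: "ell2_nth (eval_op (path_elem (fst a) (snd a)) (ket (enc q))) (enc (act (snd b) q)) =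
        (if a = b then 1 else 0)" if a: "a \<in> A" for a
    proof (cases "v = path_range E (fst a) (snd a)")
      case True
      have "enc (act (snd b) q) = enc (act (snd a) q) \<longleftrightarrow> act (snd b) q = act (snd a) q"
      proof (rule enc_eq_iff)
        show "fst b \<in> verts E" "fst a \<in> verts E"
          using path[OF a] path[OF b] by (auto intro: rev_path_start)
        show "act (snd b) q \<in> D (fst b)" "act (snd a) q \<in> D (fst a)"
          using act_in path[OF a] path[OF b] q bv True by auto
      qed
      also have "\<dots> \<longleftrightarrow> b = a"
        using act_eq_iff[OF path[OF b] path[OF a]] q bv True by (auto simp: prod_eq_iff)
      finally show ?thesis
        using True by (auto simp: eval_op_path[OF path[OF a] v q])
    next
      case False
      then show ?thesis using bv by (auto simp: eval_op_path[OF path[OF a] v q])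
    qed
    have "0 = (\<Sum>a\<in>A. c a * (if a = b then 1 else 0))"
      using arg_cong[OF 0, of "\<lambda>x. ell2_nth x (enc (act (snd b) q))"]
      by (simp add: pA eval_op_sum eval_op_simps ell2_nth_sum coord)
    then show ?thesis using A(1) b by (simp add: if_distrib cong: if_cong)
  qed
  have "fcong E (fscale (c a) (path_elem (fst a) (snd a)) * vert v) 0" if a: "a \<in> A" for a
  proof (cases "v = path_range E (fst a) (snd a)")
    case True
    then show ?thesis using c0[OF a] by simp
  next
    case False
    then have "fcong E (path_elem (fst a) (snd a) * vert v) 0"
      using path_elem_range[OF path[OF a]] path_range_in_verts[OF path[OF a]] v
      by (intro fcong_mult_vert_vert_0) auto
    then have "fcong E (fscale (c a) (path_elem (fst a) (snd a) * vert v)) (fscale (c a) 0)"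
      by (rule fcong_scale)
    then show ?thesis by (simp add: fscale_simps)
  qed
  then show ?thesis
    unfolding pA sum_distrib_right by (intro fcong_sum_0)
qed

text \<open>
  Induction on \<open>N\<close>: multiplication by an edge on the right lowers \<open>N\<close>, so \<open>t e = 0\<close> for all edges
  \<open>e\<close>.  If \<open>v\<close> is regular, then \<open>t v\<close> is a sum of terms \<open>t e e\<^sup>*\<close>.  Otherwise the trivial path at \<open>v\<close>
  is a boundary path that is killed by all \<open>e\<^sup>*\<close> and thus detects the summands of \<open>t v\<close> without \<open>e\<^sup>*\<close>.
\<close>

lemma eval_op_0_imp_fcong_0:
  assumes "mono_span E N t" "eval_op t = (\<lambda>_. 0)"
  shows "fcong E t 0"
  using assms
proof (induction N arbitrary: t)
  case 0
  then show ?case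
    using base_in by (intro fcong_0I[OF 0(1)] path_span_eval_0[OF 0(1) _ base_in]) auto
next
  case (Suc N)
  have edge0: "fcong E (t * edge e) 0" if e: "e \<in> arcs E" for e
  proof -
    obtain y where y: "mono_span E N y" "fcong E (t * edge e) y"
      using mono_span_Suc_mult_edge[OF Suc.prems(1) HOL.refl e] by blast
    have "eval_op y = (\<lambda>_. 0)"
      unfolding eval_op_cong[OF y(2), symmetric] by (simp add: fun_eq_iff eval_op_simps Suc.prems(2))
    then have "fcong E y 0" by (rule Suc.IH[OF y(1)])
    with y(2) show ?thesis by (rule fcong_trans)
  qed
  show ?case
  proof (rule fcong_0I[OF Suc.prems(1)])
    fix v assume v: "v \<in> verts E"
    show "fcong E (t * vert v) 0"
    proof (cases "regular_vertex E v")
      case True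
      have "fcong E (t * vert v) (t * (\<Sum>e\<in>out_arcs E v. edge e * ghost e))"
        by (intro fcong_mult_right fcong_regular True)
      also have "t * (\<Sum>e\<in>out_arcs E v. edge e * ghost e) =
          (\<Sum>e\<in>out_arcs E v. t * edge e * ghost e)"
        by (simp add: sum_distrib_left mult.assoc)
      also have "fcong E \<dots> (\<Sum>e\<in>out_arcs E v. 0 * ghost e)"
        by (intro fcong_sum fcong_mult_left edge0) simp
      finally show ?thesis by simp
    next
      case False
      obtain p A y where p: "mono_span E 0 p" and A: "finite A" "A \<subseteq> arcs E"
        and t: "t = p + (\<Sum>e\<in>A. y e * ghost e)"
        using mono_span_Suc_expand[OF Suc.prems(1) HOL.refl] by (elim exE conjE)
      have "eval_op (y e * ghost e) (ket (enc (base v))) = 0" if "e \<in> A" for e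
        using that A(2) adjoint_edge_op_ket[OF _ v base_in[OF v] base_not_ext[OF v False]]
        by (auto simp: eval_op_simps eval_op_generators bounded_operatorD(4)[OF bounded_eval_op])
      then have "eval_op p (ket (enc (base v))) = eval_op t (ket (enc (base v)))"
        by (simp add: t eval_op_simps eval_op_sum)
      then have pv: "fcong E (p * vert v) 0"
        using Suc.prems(2) by (intro path_span_eval_0[OF p v base_in[OF v]]) simp
      \<comment> \<open>For \<open>tail E e = v\<close>, right multiplication of \<open>t\<close> by
        \<open>edge e\<close> leaves just \<open>y e * vert (head E e)\<close>: the part
        \<open>p\<close> vanishes at \<open>v\<close>, and the other ghost edges are orthogonal to
        \<open>e\<close>. By \<open>edge0\<close> this remainder is zero.\<close>
      have yv: "fcong E (y e * ghost e * vert v) 0" if eA: "e \<in> A" for e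
      proof (cases "tail E e = v")
        case False
        then show ?thesis using fcong_mult_vert_vert_0[OF ghost_tail] eA A v by auto
      next
        case True
        have e: "e \<in> arcs E" using eA A by blast
        have pe: "fcong E (p * edge e) 0"
        proof -
          have "fcong E (p * edge e) (p * vert v * edge e)"
            unfolding mult.assoc True[symmetric]
            by (intro fcong_mult_right fcong_sym[OF fcong_relations(3)] e)
          also have "fcong E \<dots> (0 * edge e)" by (intro fcong_mult_left pv)
          finally show ?thesis by simp
        qed
        have "fcong E (y f * ghost f * edge e) (if f = e then y e * vert (head E e) else 0)"
          if f: "f \<in> A" for f
        proof (cases "f = e")
          case True
          then show ?thesis
            unfolding mult.assoc using e by (auto intro: fcong_mult_right fcong_relations)
        next
          case False
          then have "fcong E (y f * (ghost f * edge e)) (y f * 0)"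
            using e f A by (intro fcong_mult_right fcong_relations) auto
          then show ?thesis using False by (simp add: mult.assoc)
        qed
        then have "fcong E (p * edge e + (\<Sum>f\<in>A. y f * ghost f * edge e))
            (0 + (\<Sum>f\<in>A. if f = e then y e * vert (head E e) else 0))"
          by (intro fcong_add pe fcong_sum)
        then have "fcong E (t * edge e) (y e * vert (head E e))"
          using A(1) eA by (simp add: t distrib_right sum_distrib_right)
        then have ye: "fcong E (y e * vert (head E e)) 0"
          using edge0[OF e] fcong_sym fcong_trans by blast
        have "fcong E (y e * ghost e * vert v) (y e * ghost e)"
          using ghost_tail[OF e] True by blast
        also have "fcong E (y e * ghost e) (y e * vert (head E e) * ghost e)"
          unfolding mult.assoc by (intro fcong_mult_right fcong_sym[OF fcong_relations(5)] e)
        also have "fcong E \<dots> (0 * ghost e)" by (intro fcong_mult_left ye)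
        finally show ?thesis by simp
      qed
      have "fcong E (p * vert v + (\<Sum>e\<in>A. y e * ghost e * vert v)) (0 + 0)"
        by (intro fcong_add pv fcong_sum_0 yv)
      then show ?thesis by (simp add: t distrib_right sum_distrib_right)
    qed
  qed
qed

lemma branching_family_faithful:
  assumes "a \<in> lpa_terms E" "b \<in> lpa_terms E"
    and eq: "term_operator (vertex_op, edge_op) a = term_operator (vertex_op, edge_op) b"
  shows "lpa_cong E a b"
proof -
  let ?t = "Add a (Scale (- 1) b)"
  have t: "?t \<in> lpa_terms E" using assms by (intro lpa_terms.intros)
  obtain N x where x: "mono_span E N x" "fcong E (abs_free_alg ?t) x"
    using term_in_mono_span[OF t] by blast
  have "term_operator branching_family ?t = (\<lambda>_. 0)"
    unfolding branching_family_def term_operator_zero_extend[OF t] by (simp add: eq)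
  then have "eval_op x = (\<lambda>_. 0)"
    using eval_op_cong[OF x(2)] by (simp add: eval_op_abs)
  then have "fcong E (abs_free_alg ?t) 0"
    using eval_op_0_imp_fcong_0[OF x(1)] x(2) fcong_trans by blast
  then have "fcong E (abs_free_alg a - abs_free_alg b + abs_free_alg b) (0 + abs_free_alg b)"
    by (intro fcong_add) (simp_all add: abs_free_alg_simps fscale_simps)
  then show ?thesis by (simp add: fcong_abs_iff)
qed

end

theorem lpa_cong_iff_term_operator_eq:
  assumes "wf_digraph E" "countable (verts E)" "countable (arcs E)"
    and "a \<in> lpa_terms E" "b \<in> lpa_terms E"
  shows "lpa_cong E a b \<longleftrightarrow> (\<forall>\<rho>\<in>ck_families E. term_operator \<rho> a = term_operator \<rho> b)"
proof
  interpret graded_branching_system E "boundary_points E" "boundary_ext E"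
    "to_nat_on (\<Union>v\<in>verts E. boundary_points E v)" "\<lambda>v. (v, [], 0)" "\<lambda>(v, es, k). k"
    using assms(1-3) by (rule boundary_graded_branching_system)
  assume "\<forall>\<rho>\<in>ck_families E. term_operator \<rho> a = term_operator \<rho> b"
  then show "lpa_cong E a b"
    using branching_family_faithful assms(4,5) in_ck_families by blast
qed (use lpa_cong_imp_term_operator_eq assms in blast)

section \<open>Homomorphisms of Leavitt path algebras\<close>

lemma lpa_embedding_simps:
  assumes "wf_digraph E" "\<rho> \<in> ck_families E"
    and x: "x \<in> alg_carrier (leavitt_path_algebra E)"
    and y: "y \<in> alg_carrier (leavitt_path_algebra E)"
  shows "bounded_operator (lpa_embedding E x \<rho>)"
    "lpa_embedding E (alg_add (leavitt_path_algebra E) x y) \<rho> =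
      (\<lambda>p. lpa_embedding E x \<rho> p + lpa_embedding E y \<rho> p)"
    "lpa_embedding E (alg_mult (leavitt_path_algebra E) x y) \<rho> =
      (\<lambda>p. lpa_embedding E x \<rho> (lpa_embedding E y \<rho> p))"
    "lpa_embedding E (alg_scale (leavitt_path_algebra E) k x) \<rho> =
      (\<lambda>p. cscale k (lpa_embedding E x \<rho> p))"
    "lpa_embedding E (alg_star (leavitt_path_algebra E) x) \<rho> = adjoint (lpa_embedding E x \<rho>)"
proof -
  obtain a b where ab: "a \<in> lpa_terms E" "x = lpa_class E a" "b \<in> lpa_terms E" "y = lpa_class E b"
    using x y by (metis lpa_carrierE)
  then show "bounded_operator (lpa_embedding E x \<rho>)"
    "lpa_embedding E (alg_add (leavitt_path_algebra E) x y) \<rho> =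
      (\<lambda>p. lpa_embedding E x \<rho> p + lpa_embedding E y \<rho> p)"
    "lpa_embedding E (alg_mult (leavitt_path_algebra E) x y) \<rho> =
      (\<lambda>p. lpa_embedding E x \<rho> (lpa_embedding E y \<rho> p))"
    "lpa_embedding E (alg_scale (leavitt_path_algebra E) k x) \<rho> =
      (\<lambda>p. cscale k (lpa_embedding E x \<rho> p))"
    "lpa_embedding E (alg_star (leavitt_path_algebra E) x) \<rho> = adjoint (lpa_embedding E x \<rho>)"
    by (simp_all add: leavitt_path_algebra_class_simps lpa_embedding_class[OF assms(1,2)]
        lpa_terms.intros star_term_in_lpa_terms term_operator_star_term[OF assms(2)]
        bounded_operator_term_operator[OF assms(2)] o_def)
qed

lemma lpa_embedding_inject:
  assumes "wf_digraph E" "countable (verts E)" "countable (arcs E)"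
    and "x \<in> alg_carrier (leavitt_path_algebra E)" "y \<in> alg_carrier (leavitt_path_algebra E)"
    and eq: "\<And>\<rho>. \<rho> \<in> ck_families E \<Longrightarrow> lpa_embedding E x \<rho> = lpa_embedding E y \<rho>"
  shows "x = y"
proof -
  obtain a b where ab: "a \<in> lpa_terms E" "x = lpa_class E a" "b \<in> lpa_terms E" "y = lpa_class E b"
    using assms(4,5) by (metis lpa_carrierE)
  then have "term_operator \<rho> a = term_operator \<rho> b" if "\<rho> \<in> ck_families E" for \<rho>
    using eq[OF that] by (simp add: lpa_embedding_class[OF assms(1) that])
  then show ?thesis
    using ab lpa_class_eq_iff lpa_cong_iff_term_operator_eq[OF assms(1-3)] by metis
qed

lemma lpa_norm_le_1_iff_embedding:
  assumes E: "wf_digraph E" and x: "x \<in> alg_carrier (leavitt_path_algebra E)"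
  shows "lpa_norm E x \<le> 1 \<longleftrightarrow>
    (\<forall>\<rho>\<in>ck_families E. \<forall>p. norm (lpa_embedding E x \<rho> p) \<le> norm p)"
  using x by (elim lpa_carrierE) (simp add: lpa_norm_le_1_iff[OF E] lpa_embedding_class[OF E])

theorem proposition5p3:
  fixes E :: "('v, 'e) pre_digraph" and F :: "('w, 'f) pre_digraph"
    and \<psi> :: "('v, 'e) lpa_term set \<Rightarrow> ('w, 'f) lpa_term set"
  assumes "wf_digraph E" and "countable (verts E)" and "countable (arcs E)"
    and "wf_digraph F" and "countable (verts F)" and "countable (arcs F)"
    and "algebra_hom (leavitt_path_algebra E) (leavitt_path_algebra F) \<psi>"
  shows "algebra_star_hom (leavitt_path_algebra E) (leavitt_path_algebra F) \<psi> \<longleftrightarrow>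
    (\<forall>e\<in>arcs E. lpa_norm F (\<psi> (lpa_edge E e)) \<le> 1 \<and>
       lpa_norm F (\<psi> (alg_star (leavitt_path_algebra E) (lpa_edge E e))) \<le> 1) \<and>
    (\<forall>v\<in>verts E. source_vertex E v \<longrightarrow> lpa_norm F (\<psi> (lpa_vertex E v)) \<le> 1)"
    (is "?L \<longleftrightarrow> ?R")
proof -
  interpret E: wf_digraph E by (rule assms(1))
  \<comment> \<open>The operator of \<open>\<psi>\<close> on a term in the representation
    \<open>\<rho>\<close>. Terms instead of classes as arguments make induction over
    \<open>lpa_terms\<close> available.\<close>
  define \<Phi> where "\<Phi> \<rho> t = lpa_embedding F (\<psi> (lpa_class E t)) \<rho>" for \<rho> t
  have hom: "\<psi> x \<in> alg_carrier (leavitt_path_algebra F)"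
    "\<psi> (alg_add (leavitt_path_algebra E) x y) = alg_add (leavitt_path_algebra F) (\<psi> x) (\<psi> y)"
    "\<psi> (alg_scale (leavitt_path_algebra E) k x) = alg_scale (leavitt_path_algebra F) k (\<psi> x)"
    "\<psi> (alg_mult (leavitt_path_algebra E) x y) = alg_mult (leavitt_path_algebra F) (\<psi> x) (\<psi> y)"
    if "x \<in> alg_carrier (leavitt_path_algebra E)" "y \<in> alg_carrier (leavitt_path_algebra E)"
    for x y k
    using assms(7) that by (auto simp: algebra_hom_def)
  note cl = lpa_class_in_carrier[of _ E]
  note img = hom(1)[OF cl cl]
  note terms = lpa_terms.intros[where E = E]
  have star: "alg_star (leavitt_path_algebra E) (lpa_class E t) = lpa_class E (star_term t)"
    if "t \<in> lpa_terms E" for t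
    using that by (rule leavitt_path_algebra_class_simps)
  have bdd: "bounded_operator (\<Phi> \<rho> t)" if "\<rho> \<in> ck_families F" "t \<in> lpa_terms E" for \<rho> t
    unfolding \<Phi>_def
    by (rule lpa_embedding_simps(1)[OF assms(4) that(1) img[OF that(2,2)] img[OF that(2,2)]])
  have add: "\<Phi> \<rho> (Add a b) = (\<lambda>p. \<Phi> \<rho> a p + \<Phi> \<rho> b p)"
    and mult: "\<Phi> \<rho> (Mult a b) = (\<lambda>p. \<Phi> \<rho> a (\<Phi> \<rho> b p))"
    and scale: "\<Phi> \<rho> (Scale k a) = (\<lambda>p. cscale k (\<Phi> \<rho> a p))"
    if \<rho>: "\<rho> \<in> ck_families F" and a: "a \<in> lpa_terms E" and b: "b \<in> lpa_terms E" for \<rho> a b k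
    unfolding \<Phi>_def
    using lpa_embedding_simps(2-4)[OF assms(4) \<rho> img[OF a a] img[OF b b]]
      hom(2-4)[OF cl[OF a] cl[OF b]]
    by (simp_all add: leavitt_path_algebra_class_simps[OF a] b)
  have cong: "\<Phi> \<rho> a = \<Phi> \<rho> b" if "a \<in> lpa_terms E" "b \<in> lpa_terms E" "lpa_cong E a b" for \<rho> a b
    unfolding \<Phi>_def using that lpa_class_eq_iff by metis
  have norm: "lpa_norm F (\<psi> (lpa_class E t)) \<le> 1 \<longleftrightarrow>
      (\<forall>\<rho>\<in>ck_families F. \<forall>p. norm (\<Phi> \<rho> t p) \<le> norm p)" if "t \<in> lpa_terms E" for t
    unfolding \<Phi>_def using that by (intro lpa_norm_le_1_iff_embedding assms(4) img)
  have V_idem: "\<Phi> \<rho> (Vertex v) (\<Phi> \<rho> (Vertex v) p) = \<Phi> \<rho> (Vertex v) p"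
    if "\<rho> \<in> ck_families F" "v \<in> verts E" for \<rho> v p
    using cong[OF _ _ lpa_cong.vertex_idem[OF that(2)], of \<rho>] mult[OF that(1)] that(2)
    by (simp add: terms fun_eq_iff)
  have GE: "\<Phi> \<rho> (Ghost e) (\<Phi> \<rho> (Edge e) p) = \<Phi> \<rho> (Vertex (head E e)) p"
    if "\<rho> \<in> ck_families F" "e \<in> arcs E" for \<rho> e p
    using cong[OF _ _ lpa_cong.ghost_edge[OF that(2)], of \<rho>] mult[OF that(1)] that(2)
    by (simp add: terms fun_eq_iff)
  \<comment> \<open>The only use of injectivity: the identity in the algebra of \<open>F\<close> is
    replaced by identities of operators.\<close>
  have star_hom_iff: "?L \<longleftrightarrow>
      (\<forall>\<rho>\<in>ck_families F. \<forall>t\<in>lpa_terms E. \<Phi> \<rho> (star_term t) = adjoint (\<Phi> \<rho> t))"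
  proof -
    have "?L \<longleftrightarrow> (\<forall>t\<in>lpa_terms E. \<psi> (lpa_class E (star_term t)) =
        alg_star (leavitt_path_algebra F) (\<psi> (lpa_class E t)))"
      unfolding algebra_star_hom_def using assms(7) star cl by (metis lpa_carrierE)
    also have "\<dots> \<longleftrightarrow>
        (\<forall>t\<in>lpa_terms E. \<forall>\<rho>\<in>ck_families F. \<Phi> \<rho> (star_term t) = adjoint (\<Phi> \<rho> t))"
    proof (intro ball_cong HOL.refl)
      fix t assume t: "t \<in> lpa_terms E"
      have adj: "lpa_embedding F (alg_star (leavitt_path_algebra F) (\<psi> (lpa_class E t))) \<rho> =
          adjoint (\<Phi> \<rho> t)" if "\<rho> \<in> ck_families F" for \<rho>
        unfolding \<Phi>_def by (rule lpa_embedding_simps(5)[OF assms(4) that img[OF t t] img[OF t t]])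
      have "alg_star (leavitt_path_algebra F) (\<psi> (lpa_class E t)) \<in>
          alg_carrier (leavitt_path_algebra F)"
        using img[OF t t] by (elim lpa_carrierE)
          (simp add: leavitt_path_algebra_class_simps lpa_class_in_carrier star_term_in_lpa_terms)
      then show "\<psi> (lpa_class E (star_term t)) =
          alg_star (leavitt_path_algebra F) (\<psi> (lpa_class E t)) \<longleftrightarrow>
          (\<forall>\<rho>\<in>ck_families F. \<Phi> \<rho> (star_term t) = adjoint (\<Phi> \<rho> t))"
        using adj lpa_embedding_inject[OF assms(4-6)] img star_term_in_lpa_terms[OF t]
        unfolding \<Phi>_def by metis
    qed
    finally show ?thesis by blast
  qed
  show ?thesis
  proof
    assume ?L
    then have adj: "\<Phi> \<rho> (star_term t) = adjoint (\<Phi> \<rho> t)"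
      if "\<rho> \<in> ck_families F" "t \<in> lpa_terms E" for \<rho> t
      using that star_hom_iff by blast
    have V: "norm (\<Phi> \<rho> (Vertex v) p) \<le> norm p" if \<rho>: "\<rho> \<in> ck_families F" and v: "v \<in> verts E" for \<rho> v p
    proof (rule selfadjoint_idempotent_contractive)
      show "\<Phi> \<rho> (Vertex v) x \<bullet> y = x \<bullet> \<Phi> \<rho> (Vertex v) y" for x y
        using adj[OF \<rho> terms(1)[OF v]]
          inner_adjoint(1)[OF bounded_operatorD(1)[OF bdd[OF \<rho> terms(1)[OF v]]]] by simp
    qed (rule V_idem[OF \<rho> v])
    have S: "norm (\<Phi> \<rho> (Edge e) p) \<le> norm p" "norm (\<Phi> \<rho> (Ghost e) p) \<le> norm p"
      if \<rho>: "\<rho> \<in> ck_families F" and e: "e \<in> arcs E" for \<rho> e p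
    proof -
      note b = bounded_operatorD(1)[OF bdd[OF \<rho> terms(2)[OF e]]]
      have G: "\<Phi> \<rho> (Ghost e) = adjoint (\<Phi> \<rho> (Edge e))" using adj[OF \<rho> terms(2)[OF e]] by simp
      show S: "norm (\<Phi> \<rho> (Edge e) p) \<le> norm p" for p
        \<comment> \<open>The adjoint of the edge operator times the operator itself is the image of
          a vertex, already known to be a contraction.\<close>
        using V[OF \<rho> E.head_in_verts[OF e]]
        by (intro contractive_adjoint_comp_imp_contractive[OF b]) (simp add: G[symmetric] GE \<rho> e)
      show "norm (\<Phi> \<rho> (Ghost e) p) \<le> norm p"
        unfolding G by (rule contractive_adjoint[OF b S])
    qed
    show ?R
      unfolding lpa_edge_def lpa_vertex_def
      by (simp add: star terms norm V S)
  next
    assume R: ?R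
    have S: "norm (\<Phi> \<rho> (Edge e) p) \<le> norm p" "norm (\<Phi> \<rho> (Ghost e) p) \<le> norm p"
      if "\<rho> \<in> ck_families F" "e \<in> arcs E" for \<rho> e p
      using R that unfolding lpa_edge_def by (simp_all add: star terms norm)
    have V: "norm (\<Phi> \<rho> (Vertex v) p) \<le> norm p" if \<rho>: "\<rho> \<in> ck_families F" and v: "v \<in> verts E" for \<rho> v p
    proof (cases "source_vertex E v")
      case True
      then show ?thesis using R \<rho> v unfolding lpa_vertex_def by (simp add: terms norm)
    next
      case False
      then obtain e where e: "e \<in> arcs E" "head E e = v"
        using v by (auto simp: source_vertex_def in_arcs_def)
      have "norm (\<Phi> \<rho> (Ghost e) (\<Phi> \<rho> (Edge e) p)) \<le> norm p"
        using S[OF \<rho> e(1)] order_trans by blast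
      then show ?thesis using GE[OF \<rho> e(1)] e(2) by simp
    qed
    \<comment> \<open>In \<open>contractive_inverse_eq_adjoint\<close>, \<open>A\<close> and
      \<open>B\<close> are the images of the edge and its ghost edge, and \<open>P\<close> is the
      image of the range vertex.\<close>
    have Edge_adj: "\<Phi> \<rho> (Ghost e) = adjoint (\<Phi> \<rho> (Edge e))"
      if \<rho>: "\<rho> \<in> ck_families F" and e: "e \<in> arcs E" for \<rho> e
    proof (rule adjoint_eqI[symmetric], rule contractive_inverse_eq_adjoint)
      show "linear (\<Phi> \<rho> (Edge e))" "linear (\<Phi> \<rho> (Ghost e))"
        by (rule bounded_linear.linear, rule bounded_operatorD(1), rule bdd[OF \<rho>], rule terms, rule e)+
      show "\<Phi> \<rho> (Ghost e) (\<Phi> \<rho> (Edge e) x) = \<Phi> \<rho> (Vertex (head E e)) x" for x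
        by (rule GE[OF \<rho> e])
      show "\<Phi> \<rho> (Edge e) (\<Phi> \<rho> (Vertex (head E e)) x) = \<Phi> \<rho> (Edge e) x" for x
        using cong[OF _ _ lpa_cong.edge_range[OF e], of \<rho>] mult[OF \<rho>] e
        by (simp add: terms fun_eq_iff)
      show "\<Phi> \<rho> (Vertex (head E e)) (\<Phi> \<rho> (Ghost e) x) = \<Phi> \<rho> (Ghost e) x" for x
        using cong[OF _ _ lpa_cong.range_ghost[OF e], of \<rho>] mult[OF \<rho>] e
        by (simp add: terms fun_eq_iff)
    qed (rule S[OF \<rho> e])+
    have "\<Phi> \<rho> (star_term t) = adjoint (\<Phi> \<rho> t)"
      if \<rho>: "\<rho> \<in> ck_families F" and t: "t \<in> lpa_terms E" for \<rho> t
      using t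
    proof induction
      case (1 v)
      have "linear (\<Phi> \<rho> (Vertex v))"
        by (rule bounded_linear.linear, rule bounded_operatorD(1), rule bdd[OF \<rho>], rule terms, rule 1)
      then have "adjoint (\<Phi> \<rho> (Vertex v)) = \<Phi> \<rho> (Vertex v)"
        by (intro adjoint_eqI contractive_idempotent_selfadjoint V_idem V \<rho> 1)
      then show ?case by simp
    next
      case (2 e)
      then show ?case by (simp add: Edge_adj[OF \<rho>])
    next
      case (3 e)
      then show ?case by (simp add: Edge_adj[OF \<rho>] adjoint_adjoint_ell2 bdd[OF \<rho>] terms)
    next
      case 4
      \<comment> \<open>\<open>algebra_hom\<close> has no clause for zero; additivity applied to
        \<open>0 + 0 = 0\<close> supplies it.\<close>
      have "\<Phi> \<rho> Zero = (\<lambda>_. 0)"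
        using cong[OF _ _ lpa_cong.add_zero, of Zero \<rho>] add[OF \<rho>, of Zero Zero]
        by (simp add: terms fun_eq_iff)
      then show ?case by (simp add: adjoint_zero)
    next
      case (5 a b)
      then show ?case
        by (simp add: add[OF \<rho>] star_term_in_lpa_terms adjoint_add bdd[OF \<rho>])
    next
      case (6 a k)
      then show ?case
        by (simp add: scale[OF \<rho> _ terms(4)] star_term_in_lpa_terms adjoint_cscale bdd[OF \<rho>])
    next
      case (7 a b)
      then show ?case
        by (simp add: mult[OF \<rho>] star_term_in_lpa_terms adjoint_comp bdd[OF \<rho>])
    qed
    then show ?L using star_hom_iff by blast
  qed
qed

end
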